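(* Let $s_0^{[2]},\dots,s_7^{[2]},\pi^{[2]}$ and $\varphi_{23}$ be the automorphisms of the field $K=\mathbb C(e_1,\dots,e_8,h_1,h_2,x,y)$ given in the context, and define $$s_i^{[3]}=\varphi_{23}\,s_i^{[2]}\,\varphi_{23}^{-1}\ (i=0,\dots,7),\qquad \pi^{[3]}=\varphi_{23}\,\pi^{[2]}\,\varphi_{23}^{-1}.$$ Then these automorphisms act on the parameters by $$s_0^{[3]}=r_{34},\ s_1^{[3]}=\nu_{12},\ s_2^{[3]}=c,\ s_3^{[3]}=\nu_{34},\ s_4^{[3]}=r_{45},\ s_5^{[3]}=r_{56},\ s_6^{[3]}=r_{67},\ s_7^{[3]}=r_{78},$$ $$\pi^{[3]}:\ h_1\mapsto\frac{h_1^2h_2^2}{e_2^2e_3e_4e_5e_6},\quad h_2\mapsto\frac{h_1^2h_2^2}{e_2^2e_3e_4e_5e_7},\quad e_1\leftrightarrow e_8,\quad e_2\mapsto\frac{h_1^2h_2^2}{e_2^2e_3e_4e_5e_6e_7},$$ $$e_3\mapsto\frac{h_1h_2}{e_2e_4e_5},\quad e_4\mapsto\frac{h_1h_2}{e_2e_3e_5},\quad e_5\mapsto\frac{h_1h_2}{e_2e_3e_4},\quad e_6\mapsto\frac{h_2}{e_2},\quad e_7\mapsto\frac{h_1}{e_2},$$ and on $x,y$ by $$s_1^{[3]}:\ y\mapsto\frac{-h_2(e_1e_2-h_1)x+h_1(e_1e_2-h_2)y}{e_1e_2h_-},\qquad s_2^{[3]}:\ x\leftrightarrow y,$$ $$s_3^{[3]}:\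 y\mapsto\frac{a_2h_-xy+a_1h_2(a_2-h_1)x-a_1h_1(a_2-h_2)y+(a_2-h_1)(a_2-h_2)h_-}{a_2\{(a_2-h_2)x-(a_2-h_1)y-a_1h_-\}},$$ $$\pi^{[3]}:\ x\mapsto\Phi,\qquad y\mapsto\Phi|_{e_6\to e_7},$$ $$\Phi=\frac{h_1h_2\{(b_4(x-y)-h_-b_3)(x-y)+(h_2x-h_1y+h_-b_1)(h_2x-h_1y)+b_2h_-^2\}}{e_2b_4\{h_2x^2+h_1y^2-h_+xy+h_-^2\}},$$ all variables $x,y$ not mentioned for a given generator being fixed, where $h_\pm=h_1\pm h_2$, $\prod_{i=3}^4(1+te_i)=\sum_{i=0}^2a_it^i$ and $\prod_{i=3}^6(1+te_i)=\sum_{i=0}^4b_it^i$.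
   Context: All maps are $\mathbb C$-automorphisms of the rational function field $K=\mathbb C(e_1,\dots,e_8,h_1,h_2,x,y)$; composition is $(\alpha\beta)(F)=\alpha(\beta(F))$; generators of $K$ not mentioned are fixed. On the parameters define $$r_{ij}:e_i\leftrightarrow e_j;\quad c:h_1\leftrightarrow h_2;\quad \mu_{ij}:e_i\mapsto\tfrac{h_2}{e_j},\ e_j\mapsto\tfrac{h_2}{e_i},\ h_1\mapsto\tfrac{h_1h_2}{e_ie_j};\quad \nu_{ij}:e_i\mapsto\tfrac{h_1}{e_j},\ e_j\mapsto\tfrac{h_1}{e_i},\ h_2\mapsto\tfrac{h_1h_2}{e_ie_j}.$$ Representation 2. On parameters: $s_0^{[2]}=\mu_{34}$, $s_1^{[2]}=r_{12}$, $s_2^{[2]}=\nu_{23}$, $s_3^{[2]}=r_{34}$, $s_4^{[2]}=r_{45}$, $s_5^{[2]}=r_{56}$, $s_6^{[2]}=r_{67}$, $s_7^{[2]}=r_{78}$, and $\pi^{[2]}: h_1\mapsto h_1$, $h_2\mapsto\frac{h_1^2h_2}{e_3e_4e_5e_6}$, $e_1\leftrightarrow e_8$, $e_2\leftrightarrow e_7$, $e_i\mapsto\frac{h_1}{e_{9-i}}$ $(i=3,4,5,6)$. On $x,y$ (all others fixed), with $a_i,b_i$ as in the claim: $$s_0^{[2]}:x\mapsto\frac{h_2(xy-a_1x+a_2-h_2)}{(h_2-a_2)x+a_2y-a_1h_2};\quad s_2^{[2]}:y\mapsto\frac{e_2e_3xy-e_3(e_2e_3-h_1)x-e_3h_1y-h_2(e_2e_3-h_1)}{e_2e_3(x-e_3)};$$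 $$\pi^{[2]}:x\mapsto\frac{h_1}{x},\quad y\mapsto\frac{h_1\{h_2x^2y-h_2b_1x^2-(b_4-h_2b_2+h_2^2)x+b_4y-h_2b_3\}}{b_4(xy-x^2-h_2)}.$$ The automorphism $\varphi_{23}$ is $$\varphi_{23}:\ x\mapsto\frac{e_3(h_1-h_2)+h_2x-h_1y}{e_3x-e_3y-h_1+h_2},\quad y\mapsto x,\quad e_2\mapsto\frac{h_1}{e_2},\ e_3\mapsto\frac{h_1}{e_3},\ h_1\mapsto\frac{h_1h_2}{e_2e_3},\ h_2\mapsto h_1.$$ *)

theory Defs
  imports
    "HOL-Library.Poly_Mapping"
    "HOL-Computational_Algebra.Fraction_Field"
    "HOL-Computational_Algebra.Polynomial"
begin

section \<open>The field of rational functions over the complex numbers\<close>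

datatype var = E1 | E2 | E3 | E4 | E5 | E6 | E7 | E8 | H1 | H2 | X | Y

text \<open>
  The order on the variables carries no mathematical content: the library proves that the ring of
  finitely supported maps from monomials to coefficients is an integral domain only for linearly
  ordered variables.
\<close>

primrec var_rank :: "var \<Rightarrow> nat" where
  "var_rank E1 = 1" | "var_rank E2 = 2" | "var_rank E3 = 3" | "var_rank E4 = 4"
| "var_rank E5 = 5" | "var_rank E6 = 6" | "var_rank E7 = 7" | "var_rank E8 = 8"
| "var_rank H1 = 9" | "var_rank H2 = 10" | "var_rank X = 11" | "var_rank Y = 12"

lemma var_rank_eq_iff: "var_rank v = var_rank w \<longleftrightarrow> v = w"
  by (cases v; cases w) simp_all

instantiation var :: linorder
begin

definition less_eq_var :: "var \<Rightarrow> var \<Rightarrow> bool" where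
  "v \<le> w \<longleftrightarrow> var_rank v \<le> var_rank w"

definition less_var :: "var \<Rightarrow> var \<Rightarrow> bool" where
  "v < w \<longleftrightarrow> var_rank v < var_rank w"

instance
  by standard (auto simp: less_eq_var_def less_var_def var_rank_eq_iff[symmetric])

end

text \<open>Exponent vectors are maps from variables to natural numbers.\<close>

type_synonym cpoly = "(var \<Rightarrow>\<^sub>0 nat) \<Rightarrow>\<^sub>0 complex"
type_synonym K = "cpoly fract"

definition const :: "complex \<Rightarrow> K" where
  "const z = Fraction_Field.Fract (Poly_Mapping.single 0 z) 1"

definition gen :: "var \<Rightarrow> K" where
  "gen v = Fraction_Field.Fract (Poly_Mapping.single (Poly_Mapping.single v 1) 1) 1"

text \<open>\<open>evar i\<close> is meaningful for \<open>1 \<le> i \<le> 8\<close> only.\<close>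

definition evar :: "nat \<Rightarrow> var" where
  "evar i = [E1, E2, E3, E4, E5, E6, E7, E8] ! (i - 1)"

definition \<e> :: "nat \<Rightarrow> K" where "\<e> i = gen (evar i)"
definition \<h>\<^sub>1 :: K where "\<h>\<^sub>1 = gen H1"
definition \<h>\<^sub>2 :: K where "\<h>\<^sub>2 = gen H2"
definition \<x> :: K where "\<x> = gen X"
definition \<y> :: K where "\<y> = gen Y"


section \<open>Automorphisms over the complex numbers\<close>

definition C_automorphism :: "(K \<Rightarrow> K) \<Rightarrow> bool" where
  "C_automorphism f \<longleftrightarrow> bij f
     \<and> (\<forall>F G. f (F + G) = f F + f G)
     \<and> (\<forall>F G. f (F * G) = f F * f G)
     \<and> (\<forall>c. f (const c) = const c)"

definition acts_as :: "(K \<Rightarrow> K) \<Rightarrow> (var \<Rightarrow> K) \<Rightarrow> bool" where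
  "acts_as f \<sigma> \<longleftrightarrow> C_automorphism f \<and> (\<forall>v. f (gen v) = \<sigma> v)"

text \<open>
  Such an automorphism is unique, because the generators generate the field; existence depends
  on \<open>\<sigma>\<close>.
\<close>

definition aut :: "(var \<Rightarrow> K) \<Rightarrow> K \<Rightarrow> K" where
  "aut \<sigma> = (THE f. acts_as f \<sigma>)"


section \<open>Actions on the generators\<close>

text \<open>
  An action is given by the images of the generators, written as an update of \<^const>\<open>gen\<close>
  (the images under the identity), so that generators not mentioned are fixed.
\<close>

definition \<r> :: "nat \<Rightarrow> nat \<Rightarrow> var \<Rightarrow> K" where
  "\<r> i j = gen(evar i := \<e> j, evar j := \<e> i)"

definition \<c> :: "var \<Rightarrow> K" where
  "\<c> = gen(H1 := \<h>\<^sub>2, H2 := \<h>\<^sub>1)"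

definition \<mu> :: "nat \<Rightarrow> nat \<Rightarrow> var \<Rightarrow> K" where
  "\<mu> i j = gen(evar i := \<h>\<^sub>2 / \<e> j, evar j := \<h>\<^sub>2 / \<e> i, H1 := \<h>\<^sub>1 * \<h>\<^sub>2 / (\<e> i * \<e> j))"

definition \<nu> :: "nat \<Rightarrow> nat \<Rightarrow> var \<Rightarrow> K" where
  "\<nu> i j = gen(evar i := \<h>\<^sub>1 / \<e> j, evar j := \<h>\<^sub>1 / \<e> i, H2 := \<h>\<^sub>1 * \<h>\<^sub>2 / (\<e> i * \<e> j))"

definition \<a> :: "nat \<Rightarrow> K" where
  "\<a> i = coeff (\<Prod>k=3..4. [:1, \<e> k:]) i"

text \<open>
  The family \<open>u\<close> stands for the parameters \<open>e\<^sub>1, \<dots>, e\<^sub>8\<close>; keeping it as an argument makes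
  the formal replacement of one parameter by another expressible.
\<close>

definition \<b> :: "(nat \<Rightarrow> K) \<Rightarrow> nat \<Rightarrow> K" where
  "\<b> u i = coeff (\<Prod>k=3..6. [:1, u k:]) i"


section \<open>Representation 2 and the transition automorphism\<close>

definition s0_x :: K where
  "s0_x = \<h>\<^sub>2 * (\<x> * \<y> - \<a> 1 * \<x> + \<a> 2 - \<h>\<^sub>2)
     / ((\<h>\<^sub>2 - \<a> 2) * \<x> + \<a> 2 * \<y> - \<a> 1 * \<h>\<^sub>2)"

definition s2_y :: K where
  "s2_y = (\<e> 2 * \<e> 3 * \<x> * \<y> - \<e> 3 * (\<e> 2 * \<e> 3 - \<h>\<^sub>1) * \<x> - \<e> 3 * \<h>\<^sub>1 * \<y>
            - \<h>\<^sub>2 * (\<e> 2 * \<e> 3 - \<h>\<^sub>1))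
     / (\<e> 2 * \<e> 3 * (\<x> - \<e> 3))"

text \<open>\<open>s_rep2 i\<close> is meaningful for \<open>0 \<le> i \<le> 7\<close> only.\<close>

definition s_rep2 :: "nat \<Rightarrow> K \<Rightarrow> K" where
  "s_rep2 i = aut
     ([(\<mu> 3 4)(X := s0_x),
       \<r> 1 2,
       (\<nu> 2 3)(Y := s2_y),
       \<r> 3 4,
       \<r> 4 5,
       \<r> 5 6,
       \<r> 6 7,
       \<r> 7 8] ! i)"

definition pi_rep2 :: "K \<Rightarrow> K" where
  "pi_rep2 = aut (gen(
     H1 := \<h>\<^sub>1,
     H2 := \<h>\<^sub>1\<^sup>2 * \<h>\<^sub>2 / (\<e> 3 * \<e> 4 * \<e> 5 * \<e> 6),
     E1 := \<e> 8,
     E8 := \<e> 1,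
     E2 := \<e> 7,
     E7 := \<e> 2,
     E3 := \<h>\<^sub>1 / \<e> 6,
     E4 := \<h>\<^sub>1 / \<e> 5,
     E5 := \<h>\<^sub>1 / \<e> 4,
     E6 := \<h>\<^sub>1 / \<e> 3,
     X := \<h>\<^sub>1 / \<x>,
     Y := \<h>\<^sub>1 * (\<h>\<^sub>2 * \<x>\<^sup>2 * \<y> - \<h>\<^sub>2 * \<b> \<e> 1 * \<x>\<^sup>2
            - (\<b> \<e> 4 - \<h>\<^sub>2 * \<b> \<e> 2 + \<h>\<^sub>2\<^sup>2) * \<x> + \<b> \<e> 4 * \<y> - \<h>\<^sub>2 * \<b> \<e> 3)
          / (\<b> \<e> 4 * (\<x> * \<y> - \<x>\<^sup>2 - \<h>\<^sub>2))))"

definition phi23 :: "K \<Rightarrow> K" where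
  "phi23 = aut (gen(
     X := (\<e> 3 * (\<h>\<^sub>1 - \<h>\<^sub>2) + \<h>\<^sub>2 * \<x> - \<h>\<^sub>1 * \<y>) / (\<e> 3 * \<x> - \<e> 3 * \<y> - \<h>\<^sub>1 + \<h>\<^sub>2),
     Y := \<x>,
     E2 := \<h>\<^sub>1 / \<e> 2,
     E3 := \<h>\<^sub>1 / \<e> 3,
     H1 := \<h>\<^sub>1 * \<h>\<^sub>2 / (\<e> 2 * \<e> 3),
     H2 := \<h>\<^sub>1))"


section \<open>Representation 3\<close>

definition s_rep3 :: "nat \<Rightarrow> K \<Rightarrow> K" where
  "s_rep3 i = phi23 \<circ> s_rep2 i \<circ> inv phi23"

definition pi_rep3 :: "K \<Rightarrow> K" where
  "pi_rep3 = phi23 \<circ> pi_rep2 \<circ> inv phi23"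

definition h_plus :: K where "h_plus = \<h>\<^sub>1 + \<h>\<^sub>2"
definition h_minus :: K where "h_minus = \<h>\<^sub>1 - \<h>\<^sub>2"

definition \<Phi> :: "(nat \<Rightarrow> K) \<Rightarrow> K" where
  "\<Phi> u =
     \<h>\<^sub>1 * \<h>\<^sub>2 *
       ((\<b> u 4 * (\<x> - \<y>) - h_minus * \<b> u 3) * (\<x> - \<y>)
        + (\<h>\<^sub>2 * \<x> - \<h>\<^sub>1 * \<y> + h_minus * \<b> u 1) * (\<h>\<^sub>2 * \<x> - \<h>\<^sub>1 * \<y>)
        + \<b> u 2 * h_minus\<^sup>2)
     / (u 2 * \<b> u 4 *
         (\<h>\<^sub>2 * \<x>\<^sup>2 + \<h>\<^sub>1 * \<y>\<^sup>2 - h_plus * \<x> * \<y> + h_minus\<^sup>2))"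

end

theory Submission
  imports Defs
begin

text \<open>
  A substitution of the generators extends to an automorphism as soon as another substitution inverts
  it on the generators from both sides: evaluating at the inverse shows that no nonzero polynomial is
  killed. Each of the automorphisms of representation 2 is an involution, and the inverse of the
  transition automorphism maps \<open>Y\<close> to the expression \<open>s2_y\<close>, so all of them exist. Every denominator
  that occurs is nonzero because it does not vanish at one integer point. A conjugate \<open>g\<close> of \<open>s\<close> by
  \<open>\<phi>\<close> is characterised by \<open>g \<circ> \<phi> = \<phi> \<circ> s\<close>; comparing both sides on the generators determines \<open>g\<close>,
  and leaves identities of rational functions.
\<close>

text \<open>\<open>aut\<close> is a definite description, so nothing is known about it until an
  automorphism with the prescribed images exists; and division in \<open>K\<close> is total, so a
  quotient whose denominator vanishes would silently be 0. One partial evaluation with values in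
  \<open>K\<close> itself meets both obstacles: at a point of numerals it tests non-vanishing, at
  any other family of elements it is substitution. Characteristic zero is what lets arithmetic on
  numerals in \<open>K\<close> decide the test. In the conjugation step the image of
  \<open>X\<close> under \<open>phi23\<close> is used only through its relation free of division,
  \<open>P * (e3 * (x - y) - (h1 - h2)) = e3 * (h1 - h2) + (h2 * x - h1 * y)\<close> with
  \<open>P\<close> for that image. Each generator of representation 3 then amounts to the question
  of how its action transforms this single relation.\<close>

instance fract :: ("{idom, ring_char_0}") field_char_0
proof
  show "inj (of_nat :: nat \<Rightarrow> 'a fract)"
    by (rule injI) (simp add: of_nat_fract eq_fract)
qed

lemma const_0 [simp]: "const 0 = 0"
  and const_1 [simp]: "const 1 = 1"
  and const_add: "const (a + b) = const a + const b"
  and const_mult: "const (a * b) = const a * const b"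
  by (simp_all add: const_def single_add mult_single Zero_fract_def One_fract_def)

section \<open>Evaluation of rational functions\<close>

definition monom_eval :: "(var \<Rightarrow> K) \<Rightarrow> (var \<Rightarrow>\<^sub>0 nat) \<Rightarrow> K" where
  "monom_eval \<rho> m = (\<Prod>v\<in>Poly_Mapping.keys m. \<rho> v ^ Poly_Mapping.lookup m v)"

lemma finite_UNIV_var: "finite (UNIV :: var set)"
proof -
  have "UNIV = {E1, E2, E3, E4, E5, E6, E7, E8, H1, H2, X, Y}"
    using var.exhaust by auto
  then show ?thesis by (metis finite.emptyI finite.insertI)
qed

text \<open>Over the whole finite set of variables the index set no longer depends on the monomial,
  so adding exponents becomes a termwise law.\<close>

lemma monom_eval_UNIV: "monom_eval \<rho> m = (\<Prod>v\<in>UNIV. \<rho> v ^ Poly_Mapping.lookup m v)"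
  unfolding monom_eval_def
  by (rule prod.mono_neutral_left) (auto simp: finite_UNIV_var in_keys_iff)

lemma monom_eval_add: "monom_eval \<rho> (m + n) = monom_eval \<rho> m * monom_eval \<rho> n"
  by (simp add: monom_eval_UNIV lookup_add power_add prod.distrib)

definition poly_eval :: "(var \<Rightarrow> K) \<Rightarrow> cpoly \<Rightarrow> K" where
  "poly_eval \<rho> p = (\<Sum>m\<in>Poly_Mapping.keys p. const (Poly_Mapping.lookup p m) * monom_eval \<rho> m)"

lemma poly_eval_superset:
  assumes "finite S" "Poly_Mapping.keys p \<subseteq> S"
  shows "poly_eval \<rho> p = (\<Sum>m\<in>S. const (Poly_Mapping.lookup p m) * monom_eval \<rho> m)"
  unfolding poly_eval_def
  by (rule sum.mono_neutral_left) (use assms in \<open>auto simp: in_keys_iff\<close>)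

lemma poly_eval_add: "poly_eval \<rho> (p + q) = poly_eval \<rho> p + poly_eval \<rho> q"
proof -
  let ?S = "Poly_Mapping.keys p \<union> Poly_Mapping.keys q"
  have "poly_eval \<rho> r = (\<Sum>m\<in>?S. const (Poly_Mapping.lookup r m) * monom_eval \<rho> m)"
    if "r \<in> {p, q, p + q}" for r
    using that keys_add[of p q] by (intro poly_eval_superset) auto
  then show ?thesis
    by (simp add: lookup_add const_add distrib_right sum.distrib)
qed

lemma poly_eval_0 [simp]: "poly_eval \<rho> 0 = 0"
  by (simp add: poly_eval_def)

lemma poly_eval_sum: "poly_eval \<rho> (sum f A) = (\<Sum>i\<in>A. poly_eval \<rho> (f i))"
  by (induction A rule: infinite_finite_induct) (simp_all add: poly_eval_add)

lemma poly_eval_single: "poly_eval \<rho> (Poly_Mapping.single m c) = const c * monom_eval \<rho> m"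
  by (simp add: poly_eval_def)

lemma sum_single_lookup: "(\<Sum>m\<in>Poly_Mapping.keys p. Poly_Mapping.single m (Poly_Mapping.lookup p m)) = p"
  by (rule poly_mapping_eqI)
    (auto simp: lookup_sum lookup_single when_def in_keys_iff sum.delta)

lemma poly_eval_mult: "poly_eval \<rho> (p * q) = poly_eval \<rho> p * poly_eval \<rho> q"
proof -
  have "p * q = (\<Sum>m\<in>Poly_Mapping.keys p. \<Sum>n\<in>Poly_Mapping.keys q.
      Poly_Mapping.single (m + n) (Poly_Mapping.lookup p m * Poly_Mapping.lookup q n))"
    by (subst sum_single_lookup[of p, symmetric], subst sum_single_lookup[of q, symmetric])
      (simp add: sum_product mult_single)
  then have "poly_eval \<rho> (p * q) = (\<Sum>m\<in>Poly_Mapping.keys p. \<Sum>n\<in>Poly_Mapping.keys q.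
      (const (Poly_Mapping.lookup p m) * const (Poly_Mapping.lookup q n)) * (monom_eval \<rho> m * monom_eval \<rho> n))"
    by (simp add: poly_eval_sum poly_eval_single const_mult monom_eval_add)
  then show ?thesis
    by (simp add: sum_product poly_eval_def mult_ac)
qed

lemma poly_eval_const: "poly_eval \<rho> (Poly_Mapping.single 0 c) = const c"
  by (simp add: poly_eval_single monom_eval_def)

lemma poly_eval_gen: "poly_eval \<rho> (Poly_Mapping.single (Poly_Mapping.single v 1) 1) = \<rho> v"
  by (simp add: poly_eval_single monom_eval_def)

lemma poly_eval_1 [simp]: "poly_eval \<rho> 1 = 1"
  using poly_eval_const[of \<rho> 1] by simp

lemma poly_eval_uminus: "poly_eval \<rho> (- p) = - poly_eval \<rho> p"
  using poly_eval_add[of \<rho> p "- p"] by (simp add: add_eq_0_iff)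

text \<open>A relation, because evaluation is partial: one representing fraction whose denominator
  survives is enough, and other representatives may fail.\<close>

definition evaluates :: "(var \<Rightarrow> K) \<Rightarrow> K \<Rightarrow> K \<Rightarrow> bool" where
  "evaluates \<rho> F z \<longleftrightarrow>
     (\<exists>p q. poly_eval \<rho> q \<noteq> 0 \<and> F = Fraction_Field.Fract p q \<and> z = poly_eval \<rho> p / poly_eval \<rho> q)"

lemma evaluates_unique:
  assumes "evaluates \<rho> F z" "evaluates \<rho> F w"
  shows "z = w"
proof -
  obtain p q r s where
    *: "poly_eval \<rho> q \<noteq> 0" "F = Fraction_Field.Fract p q" "z = poly_eval \<rho> p / poly_eval \<rho> q"
       "poly_eval \<rho> s \<noteq> 0" "F = Fraction_Field.Fract r s" "w = poly_eval \<rho> r / poly_eval \<rho> s"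
    using assms unfolding evaluates_def by blast
  have "q \<noteq> 0" "s \<noteq> 0"
    using * by auto
  then have "p * s = r * q"
    using * by (simp add: eq_fract)
  then have "poly_eval \<rho> p * poly_eval \<rho> s = poly_eval \<rho> r * poly_eval \<rho> q"
    by (simp flip: poly_eval_mult)
  then show ?thesis
    using * by (simp add: frac_eq_eq)
qed

lemma evaluates_const: "evaluates \<rho> (const c) (const c)"
  unfolding evaluates_def const_def[of c]
  by (intro exI[of _ "Poly_Mapping.single 0 c"] exI[of _ 1])
    (simp add: poly_eval_const const_def)

lemma evaluates_gen: "evaluates \<rho> (gen v) (\<rho> v)"
  unfolding evaluates_def gen_def
  by (intro exI[of _ "Poly_Mapping.single (Poly_Mapping.single v 1) 1"] exI[of _ 1])
    (simp add: poly_eval_gen[simplified])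

lemma evaluates_add:
  assumes "evaluates \<rho> F z" "evaluates \<rho> G w"
  shows "evaluates \<rho> (F + G) (z + w)"
proof -
  obtain p q r s where
    *: "poly_eval \<rho> q \<noteq> 0" "F = Fraction_Field.Fract p q" "z = poly_eval \<rho> p / poly_eval \<rho> q"
       "poly_eval \<rho> s \<noteq> 0" "G = Fraction_Field.Fract r s" "w = poly_eval \<rho> r / poly_eval \<rho> s"
    using assms unfolding evaluates_def by blast
  have "q \<noteq> 0" "s \<noteq> 0"
    using * by auto
  with * show ?thesis
    unfolding evaluates_def
    by (intro exI[of _ "p * s + r * q"] exI[of _ "q * s"])
      (simp add: poly_eval_add poly_eval_mult add_frac_eq)
qed

lemma evaluates_mult:
  assumes "evaluates \<rho> F z" "evaluates \<rho> G w"
  shows "evaluates \<rho> (F * G) (z * w)"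
proof -
  obtain p q r s where
    *: "poly_eval \<rho> q \<noteq> 0" "F = Fraction_Field.Fract p q" "z = poly_eval \<rho> p / poly_eval \<rho> q"
       "poly_eval \<rho> s \<noteq> 0" "G = Fraction_Field.Fract r s" "w = poly_eval \<rho> r / poly_eval \<rho> s"
    using assms unfolding evaluates_def by blast
  then show ?thesis
    unfolding evaluates_def
    by (intro exI[of _ "p * r"] exI[of _ "q * s"]) (simp add: poly_eval_mult)
qed

lemma evaluates_uminus:
  assumes "evaluates \<rho> F z"
  shows "evaluates \<rho> (- F) (- z)"
proof -
  obtain p q where
    *: "poly_eval \<rho> q \<noteq> 0" "F = Fraction_Field.Fract p q" "z = poly_eval \<rho> p / poly_eval \<rho> q"
    using assms unfolding evaluates_def by blast
  then show ?thesis
    unfolding evaluates_def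
    by (intro exI[of _ "- p"] exI[of _ q]) (simp add: poly_eval_uminus)
qed

text \<open>A nonzero value means that the numerator survives as well, so it may serve as a
  denominator.\<close>

lemma evaluates_inverse:
  assumes "evaluates \<rho> F z" "z \<noteq> 0"
  shows "evaluates \<rho> (inverse F) (inverse z)"
proof -
  obtain p q where
    *: "poly_eval \<rho> q \<noteq> 0" "F = Fraction_Field.Fract p q" "z = poly_eval \<rho> p / poly_eval \<rho> q"
    using assms unfolding evaluates_def by blast
  then show ?thesis
    using \<open>z \<noteq> 0\<close> unfolding evaluates_def
    by (intro exI[of _ q] exI[of _ p]) simp
qed

lemma evaluates_diff:
  "evaluates \<rho> F z \<Longrightarrow> evaluates \<rho> G w \<Longrightarrow> evaluates \<rho> (F - G) (z - w)"
  using evaluates_add[of \<rho> F z "- G" "- w"] evaluates_uminus[of \<rho> G w] by simp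

lemma evaluates_divide:
  "evaluates \<rho> F z \<Longrightarrow> evaluates \<rho> G w \<Longrightarrow> w \<noteq> 0 \<Longrightarrow> evaluates \<rho> (F / G) (z / w)"
  using evaluates_mult[of \<rho> F z "inverse G" "inverse w"] evaluates_inverse[of \<rho> G w]
  by (simp add: divide_inverse)

lemma evaluates_1: "evaluates \<rho> 1 1"
  using evaluates_const[of \<rho> 1] by simp

lemma evaluates_power: "evaluates \<rho> F z \<Longrightarrow> evaluates \<rho> (F ^ n) (z ^ n)"
  by (induction n) (simp_all add: evaluates_1 evaluates_mult)

lemmas evaluates_intros =
  evaluates_gen evaluates_add evaluates_diff evaluates_uminus evaluates_mult evaluates_divide
  evaluates_power evaluates_1

lemma nonzero_if_evaluates: "evaluates \<rho> F z \<Longrightarrow> z \<noteq> 0 \<Longrightarrow> F \<noteq> 0"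
  using evaluates_unique[of \<rho> F z 0] evaluates_const[of \<rho> 0] by auto

text \<open>Evaluation at the generators is the embedding of polynomials into \<open>K\<close>. It
  turns every fraction into a quotient of two evaluations, the form on which homomorphisms and
  substitutions can act.\<close>

lemma poly_eval_generators: "poly_eval gen p = Fraction_Field.Fract p 1"
proof -
  have pow: "gen v ^ n = Fraction_Field.Fract (Poly_Mapping.single (Poly_Mapping.single v n) 1) 1"
    for v n
    by (induction n) (simp_all add: gen_def One_fract_def mult_single flip: single_add)
  have mon: "monom_eval gen m = Fraction_Field.Fract (Poly_Mapping.single m 1) 1" for m
  proof -
    have "(\<Prod>v\<in>A. gen v ^ Poly_Mapping.lookup m v) =
      Fraction_Field.Fract
        (Poly_Mapping.single (\<Sum>v\<in>A. Poly_Mapping.single v (Poly_Mapping.lookup m v)) 1) 1"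
      for A
      by (induction A rule: infinite_finite_induct) (simp_all add: pow One_fract_def mult_single)
    then show ?thesis
      by (simp add: monom_eval_def sum_single_lookup)
  qed
  have "(\<Sum>i\<in>A. Fraction_Field.Fract (f i) 1) = Fraction_Field.Fract (sum f A) 1"
    for f :: "_ \<Rightarrow> cpoly" and A :: "(var \<Rightarrow>\<^sub>0 nat) set"
    by (induction A rule: infinite_finite_induct) (simp_all add: Zero_fract_def)
  then show ?thesis
    by (simp add: poly_eval_def mon const_def mult_single sum_single_lookup)
qed

lemma Fract_poly_eval: "Fraction_Field.Fract p q = poly_eval gen p / poly_eval gen q"
  by (simp add: poly_eval_generators)

section \<open>Substitutions that extend to automorphisms\<close>

text \<open>A substitution with a left inverse kills no nonzero polynomial, hence extends to fractions.\<close>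

lemma evaluates_poly_eval:
  assumes "\<And>v. evaluates \<tau> (\<sigma> v) (gen v)"
  shows "evaluates \<tau> (poly_eval \<sigma> p) (poly_eval gen p)"
proof -
  have evaluates_sum: "evaluates \<tau> (sum f A) (sum g A)" if "\<And>i. i \<in> A \<Longrightarrow> evaluates \<tau> (f i) (g i)"
    for f g and A :: "(var \<Rightarrow>\<^sub>0 nat) set"
    using that evaluates_const[of \<tau> 0]
    by (induction A rule: infinite_finite_induct) (simp_all add: evaluates_add)
  have evaluates_prod: "evaluates \<tau> (prod f A) (prod g A)" if "\<And>i. i \<in> A \<Longrightarrow> evaluates \<tau> (f i) (g i)"
    for f g and A :: "var set"
    using that by (induction A rule: infinite_finite_induct)
      (simp_all add: evaluates_mult evaluates_1)
  show ?thesis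
    unfolding poly_eval_def monom_eval_def
    by (intro evaluates_sum evaluates_mult evaluates_const evaluates_prod evaluates_power assms)
qed

lemma poly_eval_nonzero:
  assumes "\<And>v. evaluates \<tau> (\<sigma> v) (gen v)" "p \<noteq> 0"
  shows "poly_eval \<sigma> p \<noteq> 0"
proof
  assume "poly_eval \<sigma> p = 0"
  then have "poly_eval gen p = 0"
    using evaluates_unique[OF evaluates_poly_eval[OF assms(1)], of p 0] evaluates_const[of \<tau> 0]
    by simp
  with \<open>p \<noteq> 0\<close> show False
    by (simp add: poly_eval_generators Zero_fract_def eq_fract)
qed

lemma ex_evaluates:
  assumes "\<And>v. evaluates \<tau> (\<sigma> v) (gen v)"
  shows "\<exists>z. evaluates \<sigma> F z"
proof (cases F)
  case (Fract p q)
  then show ?thesis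
    using poly_eval_nonzero[of \<tau> \<sigma> q] assms unfolding evaluates_def by blast
qed

lemma evaluates_left_inverse:
  assumes "\<And>v. evaluates \<tau> (\<sigma> v) (gen v)" "evaluates \<sigma> F z"
  shows "evaluates \<tau> z F"
proof -
  obtain p q where
    *: "poly_eval \<sigma> q \<noteq> 0" "F = Fraction_Field.Fract p q" "z = poly_eval \<sigma> p / poly_eval \<sigma> q"
    using assms(2) unfolding evaluates_def by blast
  \<comment> \<open>The identity substitution is its own left inverse, so it kills no nonzero
    polynomial either.\<close>
  then have "poly_eval gen q \<noteq> 0"
    using poly_eval_nonzero[of gen gen q] evaluates_gen[of gen] by force
  with * show ?thesis
    unfolding Fract_poly_eval
    by (auto intro!: evaluates_divide evaluates_poly_eval assms(1))
qed

section \<open>Algebraic laws of an automorphism over the complex numbers\<close>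

context
  fixes f assumes f: "C_automorphism f"
begin

lemma aut_add: "f (a + b) = f a + f b"
  and aut_mult: "f (a * b) = f a * f b"
  and aut_const: "f (const c) = const c"
  and bij_aut: "bij f"
  using f by (simp_all add: C_automorphism_def)

lemma aut_0: "f 0 = 0"
  and aut_1: "f 1 = 1"
  using aut_const[of 0] aut_const[of 1] by simp_all

lemma aut_eq_iff: "f a = f b \<longleftrightarrow> a = b"
  using bij_aut by (simp add: bij_is_inj inj_eq)

lemma aut_eq_0_iff: "f a = 0 \<longleftrightarrow> a = 0"
  using aut_eq_iff[of a 0] by (simp add: aut_0)

lemma aut_uminus: "f (- a) = - f a"
  using aut_add[of a "- a"] by (simp add: aut_0 eq_neg_iff_add_eq_0 add.commute)

lemma aut_diff: "f (a - b) = f a - f b"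
  using aut_add[of a "- b"] by (simp add: aut_uminus)

lemma aut_divide: "f (a / b) = f a / f b"
proof (cases "b = 0")
  case False
  then show ?thesis
    using aut_mult[of "a / b" b] by (simp add: aut_eq_0_iff eq_divide_eq)
qed (simp add: aut_0)

lemma aut_power: "f (a ^ n) = f a ^ n"
  by (induction n) (simp_all add: aut_1 aut_mult)

lemma aut_poly_eval: "f (poly_eval \<rho> p) = poly_eval (\<lambda>v. f (\<rho> v)) p"
proof -
  have "f (sum g A) = (\<Sum>i\<in>A. f (g i))" for g and A :: "(var \<Rightarrow>\<^sub>0 nat) set"
    by (induction A rule: infinite_finite_induct) (simp_all add: aut_0 aut_add)
  moreover have "f (prod g A) = (\<Prod>i\<in>A. f (g i))" for g and A :: "var set"
    by (induction A rule: infinite_finite_induct) (simp_all add: aut_1 aut_mult)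
  ultimately show ?thesis
    by (simp add: poly_eval_def monom_eval_def aut_mult aut_const aut_power)
qed

lemmas aut_hom = aut_add aut_mult aut_0 aut_1 aut_uminus aut_diff aut_divide aut_power

end

section \<open>Uniqueness and existence for prescribed images of the generators\<close>

lemma acts_as_unique:
  assumes "acts_as f \<sigma>" "acts_as g \<sigma>"
  shows "f = g"
proof
  fix F
  show "f F = g F"
    using assms by (cases F) (simp add: acts_as_def Fract_poly_eval aut_divide aut_poly_eval)
qed

lemma aut_eqI: "acts_as f \<sigma> \<Longrightarrow> aut \<sigma> = f"
  unfolding aut_def by (rule the_equality) (auto intro: acts_as_unique)

text \<open>The first hypothesis makes substitution by \<open>\<sigma>\<close> total on
  \<open>K\<close>, the second does the same for \<open>\<tau>\<close>. Each is then a two-sided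
  inverse of the other, which gives bijectivity.\<close>

lemma acts_as_aut:
  assumes \<tau>\<sigma>: "\<And>v. evaluates \<tau> (\<sigma> v) (gen v)" and \<sigma>\<tau>: "\<And>v. evaluates \<sigma> (\<tau> v) (gen v)"
  shows "acts_as (aut \<sigma>) \<sigma>"
proof -
  obtain f where f: "\<And>F. evaluates \<sigma> F (f F)"
    using ex_evaluates[OF \<tau>\<sigma>] by metis
  obtain g where g: "\<And>F. evaluates \<tau> F (g F)"
    using ex_evaluates[OF \<sigma>\<tau>] by metis
  have "g (f F) = F" "f (g F) = F" for F
    using evaluates_unique[OF g evaluates_left_inverse[OF \<tau>\<sigma> f]]
      evaluates_unique[OF f evaluates_left_inverse[OF \<sigma>\<tau> g]] by auto
  then have "bij f"
    by (intro bijI') metis+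
  \<comment> \<open>Since values are unique, the closure rules of the evaluation relation are the
    homomorphism laws of \<open>f\<close>.\<close>
  moreover have "f (F + G) = f F + f G" "f (F * G) = f F * f G" "f (const c) = const c"
    "f (gen v) = \<sigma> v" for F G c v
    using evaluates_unique[OF f] f evaluates_add evaluates_mult evaluates_const evaluates_gen
    by metis+
  ultimately have "acts_as f \<sigma>"
    by (simp add: acts_as_def C_automorphism_def)
  then show ?thesis
    using aut_eqI by simp
qed

lemma acts_as_aut_involution:
  "(\<And>v. evaluates \<sigma> (\<sigma> v) (gen v)) \<Longrightarrow> acts_as (aut \<sigma>) \<sigma>"
  by (rule acts_as_aut)

lemma C_automorphism_comp:
  assumes "C_automorphism f" "C_automorphism g"
  shows "C_automorphism (f \<circ> g)"
  using assms by (simp add: C_automorphism_def bij_comp)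

lemma C_automorphism_inv:
  assumes "C_automorphism f"
  shows "C_automorphism (inv f)"
proof -
  have "inv f F = G \<longleftrightarrow> F = f G" for F G
    using bij_inv_eq_iff[OF bij_aut[OF assms]] by metis
  moreover have "f (inv f F) = F" for F
    using bij_aut[OF assms] by (simp add: bij_is_surj surj_f_inv_f)
  ultimately show ?thesis
    using assms bij_imp_bij_inv[OF bij_aut[OF assms]]
    by (simp add: C_automorphism_def)
qed

section \<open>Generators, parameters and non-vanishing\<close>

lemma evaluates_gen_iff: "evaluates \<rho> (gen v) w \<longleftrightarrow> w = \<rho> v"
  using evaluates_unique evaluates_gen by blast

lemma evar_simps [simp]:
  "evar (Suc 0) = E1" "evar 1 = E1" "evar 2 = E2" "evar 3 = E3" "evar 4 = E4"
  "evar 5 = E5" "evar 6 = E6" "evar 7 = E7" "evar 8 = E8"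
  by (simp_all add: evar_def)

lemmas generator_defs = \<e>_def \<h>\<^sub>1_def \<h>\<^sub>2_def \<x>_def \<y>_def

lemma \<a>_simps: "\<a> 1 = \<e> 3 + \<e> 4" "\<a> (Suc 0) = \<e> 3 + \<e> 4" "\<a> 2 = \<e> 3 * \<e> 4"
proof -
  have "{3..4} = {3, 4::nat}" by auto
  then show "\<a> 1 = \<e> 3 + \<e> 4" "\<a> (Suc 0) = \<e> 3 + \<e> 4" "\<a> 2 = \<e> 3 * \<e> 4"
    by (simp_all add: \<a>_def numeral_2_eq_2 algebra_simps)
qed

lemma \<b>_simps:
  "\<b> u 1 = u 3 + u 4 + u 5 + u 6"
  "\<b> u (Suc 0) = u 3 + u 4 + u 5 + u 6"
  "\<b> u 2 = u 3 * u 4 + u 3 * u 5 + u 3 * u 6 + u 4 * u 5 + u 4 * u 6 + u 5 * u 6"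
  "\<b> u 3 = u 3 * u 4 * u 5 + u 3 * u 4 * u 6 + u 3 * u 5 * u 6 + u 4 * u 5 * u 6"
  "\<b> u 4 = u 3 * u 4 * u 5 * u 6"
proof -
  have *: "{3..6} = {3, 4, 5, 6::nat}" by auto
  then show "\<b> u 1 = u 3 + u 4 + u 5 + u 6"
  "\<b> u (Suc 0) = u 3 + u 4 + u 5 + u 6"
  "\<b> u 2 = u 3 * u 4 + u 3 * u 5 + u 3 * u 6 + u 4 * u 5 + u 4 * u 6 + u 5 * u 6"
  "\<b> u 3 = u 3 * u 4 * u 5 + u 3 * u 4 * u 6 + u 3 * u 5 * u 6 + u 4 * u 5 * u 6"
  "\<b> u 4 = u 3 * u 4 * u 5 * u 6"
    by (simp_all add: \<b>_def eval_nat_numeral algebra_simps)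
qed

text \<open>Leaves the value open, so that the structural rules compute it along the expression;
  comparison with the wanted value comes last.\<close>

lemma evaluates_eqI: "evaluates \<rho> F z \<Longrightarrow> z = w \<Longrightarrow> evaluates \<rho> F w"
  by simp

text \<open>The first twelve primes. Any point at which the expressions below are defined and
  nonzero would do.\<close>

primrec sample_point :: "var \<Rightarrow> K" where
  "sample_point E1 = 2" | "sample_point E2 = 3" | "sample_point E3 = 5"
| "sample_point E4 = 7" | "sample_point E5 = 11" | "sample_point E6 = 13"
| "sample_point E7 = 17" | "sample_point E8 = 19" | "sample_point H1 = 23"
| "sample_point H2 = 29" | "sample_point X = 31" | "sample_point Y = 37"

lemmas nonzero_at_sample_point = nonzero_if_evaluates[where \<rho> = sample_point]

lemma gen_nonzero [simp]: "gen v \<noteq> 0"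
  by (rule nonzero_at_sample_point, rule evaluates_gen) (cases v; simp)

lemma acts_as_r:
  assumes "(i, j) \<in> {(1, 2), (3, 4), (4, 5), (5, 6), (6, 7), (7, 8)}"
  shows "acts_as (aut (\<r> i j)) (\<r> i j)"
proof (rule acts_as_aut_involution)
  fix v
  show "evaluates (\<r> i j) (\<r> i j v) (gen v)"
    using assms by (cases v) (auto simp: \<r>_def \<e>_def evaluates_gen_iff)
qed

section \<open>The automorphisms of representation 2\<close>

text \<open>\<open>x'\<close> is fractional linear in \<open>x\<close>. The primed parameters are
  the images of \<open>a1\<close>, \<open>a2\<close> under e3 -> h2/e4, e4 -> h2/e3, and they turn
  the matrix of the map into \<open>h2 / a2\<close> times its adjugate, which represents the inverse
  map.\<close>

lemma s0_involution:
  fixes x y h2 a1 a2 :: "'a::field"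
  assumes "a2 \<noteq> 0" "h2 \<noteq> 0" "(h2 - a2) * x + a2 * y - a1 * h2 \<noteq> 0"
    "x' = h2 * (x * y - a1 * x + a2 - h2) / ((h2 - a2) * x + a2 * y - a1 * h2)"
    "a1' = h2 * a1 / a2" "a2' = h2^2 / a2"
    "(h2 - a2') * x' + a2' * y - a1' * h2 \<noteq> 0"
  shows "h2 * (x' * y - a1' * x' + a2' - h2) / ((h2 - a2') * x' + a2' * y - a1' * h2) = x"
proof -
  define D where "D = (h2 - a2) * x + a2 * y - a1 * h2"
  have x': "x' * D = h2 * (x * y - a1 * x + a2 - h2)"
    using assms by (simp add: D_def)
  have a: "a1' * a2 = h2 * a1" "a2' * a2 = h2^2"
    using assms by simp_all
  have "a2 * D * (h2 * (x' * y - a1' * x' + a2' - h2)) = a2 * D * (x * ((h2 - a2') * x' + a2' * y - a1' * h2))"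
    using x' a unfolding D_def by algebra
  with assms show ?thesis
    by (simp add: D_def divide_eq_eq)
qed

text \<open>At the image point, numerator and denominator are explicit multiples of
  \<open>y * P\<close> and \<open>P\<close>. Here \<open>P\<close> expands to
  \<open>h2 * (x^4 - b1 * x^3 + b2 * x^2 - b3 * x + b4)\<close>, free of \<open>y\<close>; for
  elementary symmetric \<open>b1\<close>, ..., \<open>b4\<close> this is \<open>h2\<close> times the
  product of the differences of \<open>x\<close> and the four parameters.\<close>

lemma pi_involution:
  fixes x y h1 h2 b1 b2 b3 b4 :: "'a::field"
  assumes nz: "b4 \<noteq> 0" "h1 \<noteq> 0" "h2 \<noteq> 0" "x \<noteq> 0" "x * y - x^2 - h2 \<noteq> 0"
    and "y' = h1 * (h2 * x^2 * y - h2 * b1 * x^2 - (b4 - h2 * b2 + h2^2) * x + b4 * y - h2 * b3) / (b4 * (x * y - x^2 - h2))"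
    and "x' = h1 / x"
    "b1' = h1 * b3 / b4" "b2' = h1^2 * b2 / b4" "b3' = h1^3 * b1 / b4" "b4' = h1^4 / b4"
    "h2' = h1^2 * h2 / b4"
    and nz': "x' * y' - x'^2 - h2' \<noteq> 0"
  shows "h1 * (h2' * x'^2 * y' - h2' * b1' * x'^2 - (b4' - h2' * b2' + h2'^2) * x' + b4' * y' - h2' * b3') / (b4' * (x' * y' - x'^2 - h2')) = y"
proof -
  define D where "D = x * y - x^2 - h2"
  define N where "N = h2 * x^2 * y - h2 * b1 * x^2 - (b4 - h2 * b2 + h2^2) * x + b4 * y - h2 * b3"
  have D: "D \<noteq> 0" using nz D_def by simp
  have y': "y' = h1 * N / (b4 * D)"
    using assms by (simp add: D_def N_def)
  have 1: "x' * y' - x'^2 - h2' = h1^2 / (x^2 * b4 * D) * (x * N - b4 * D - x^2 * h2 * D)"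
    unfolding y' assms using nz D by (simp add: field_simps eval_nat_numeral)
  have 2: "h2' * x'^2 * y' - h2' * b1' * x'^2 - (b4' - h2' * b2' + h2'^2) * x' + b4' * y' - h2' * b3'
    = h1^5 / (x^2 * b4^2 * D) * (h2 * N - h2 * b3 * D - x * (b4 - h2 * b2 + h2^2) * D + x^2 * N - x^2 * h2 * b1 * D)"
    unfolding y' assms using nz D by (simp add: field_simps eval_nat_numeral)
  have 3: "h2 * N - h2 * b3 * D - x * (b4 - h2 * b2 + h2^2) * D + x^2 * N - x^2 * h2 * b1 * D = y * (x * N - b4 * D - x^2 * h2 * D)"
    unfolding N_def D_def by algebra
  define P where "P = x * N - b4 * D - x^2 * h2 * D"
  have "P \<noteq> 0"
    using nz' unfolding 1 P_def by auto
  have "h1 * (h1^5 / (x^2 * b4^2 * D) * (y * P)) / (h1^4 / b4 * (h1^2 / (x^2 * b4 * D) * P)) = y"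
    using \<open>P \<noteq> 0\<close> nz D by (simp add: field_simps eval_nat_numeral)
  then show ?thesis
    unfolding 1 2 3 P_def using \<open>b4' = h1^4 / b4\<close> by simp
qed

text \<open>In this order: the denominators, up to parameter factors, of the moved coordinate in s0,
  s2, pi and \<open>phi23\<close>, then the difference of the two h-parameters from representation
  3.\<close>

lemma denominators_nonzero:
  "(\<h>\<^sub>2 - \<e> 3 * \<e> 4) * \<x> + \<e> 3 * \<e> 4 * \<y> - (\<e> 3 + \<e> 4) * \<h>\<^sub>2 \<noteq> 0"
  "\<x> - \<e> 3 \<noteq> 0"
  "\<x> * \<y> - \<x>\<^sup>2 - \<h>\<^sub>2 \<noteq> 0"
  "\<e> 3 * \<x> - \<e> 3 * \<y> - \<h>\<^sub>1 + \<h>\<^sub>2 \<noteq> 0"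
  "\<h>\<^sub>1 - \<h>\<^sub>2 \<noteq> 0"
  by (unfold generator_defs; rule nonzero_at_sample_point, (rule evaluates_intros)+, simp)+

lemma gen_nonzeros [simp]: "\<e> i \<noteq> 0" "\<h>\<^sub>1 \<noteq> 0" "\<h>\<^sub>2 \<noteq> 0" "\<x> \<noteq> 0" "\<y> \<noteq> 0"
  by (simp_all add: generator_defs)

lemma s0_x_eq:
  "s0_x = \<h>\<^sub>2 * (\<x> * \<y> - (\<e> 3 + \<e> 4) * \<x> + \<e> 3 * \<e> 4 - \<h>\<^sub>2)
     / ((\<h>\<^sub>2 - \<e> 3 * \<e> 4) * \<x> + \<e> 3 * \<e> 4 * \<y> - (\<e> 3 + \<e> 4) * \<h>\<^sub>2)"
  by (simp add: s0_x_def \<a>_simps)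

lemma acts_as_s0: "acts_as (aut ((\<mu> 3 4)(X := s0_x))) ((\<mu> 3 4)(X := s0_x))"
proof (rule acts_as_aut_involution)
  let ?\<sigma> = "(\<mu> 3 4)(X := s0_x)"
  have ev: "evaluates ?\<sigma> \<x> s0_x" "evaluates ?\<sigma> \<y> \<y>" "evaluates ?\<sigma> \<h>\<^sub>2 \<h>\<^sub>2"
    "evaluates ?\<sigma> (\<e> 3) (\<h>\<^sub>2 / \<e> 4)" "evaluates ?\<sigma> (\<e> 4) (\<h>\<^sub>2 / \<e> 3)"
    "evaluates ?\<sigma> \<h>\<^sub>1 (\<h>\<^sub>1 * \<h>\<^sub>2 / (\<e> 3 * \<e> 4))"
    by (simp_all add: generator_defs evaluates_gen_iff \<mu>_def)
  \<comment> \<open>The denominator of \<open>s0_x\<close> after the substitution, in the syntactic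
    shape that the evaluation rules produce.\<close>
  have nz: "(\<h>\<^sub>2 - \<h>\<^sub>2 / \<e> 4 * (\<h>\<^sub>2 / \<e> 3)) * s0_x + \<h>\<^sub>2 / \<e> 4 * (\<h>\<^sub>2 / \<e> 3) * \<y>
    - (\<h>\<^sub>2 / \<e> 4 + \<h>\<^sub>2 / \<e> 3) * \<h>\<^sub>2 \<noteq> 0"
    unfolding s0_x_eq generator_defs
    by (rule nonzero_at_sample_point, (rule evaluates_intros | (simp; fail))+)
  have eq: "\<h>\<^sub>2 / \<e> 4 + \<h>\<^sub>2 / \<e> 3 = \<h>\<^sub>2 * (\<e> 3 + \<e> 4) / (\<e> 3 * \<e> 4)"
    "\<h>\<^sub>2 / \<e> 4 * (\<h>\<^sub>2 / \<e> 3) = \<h>\<^sub>2\<^sup>2 / (\<e> 3 * \<e> 4)"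
    by (simp_all add: field_simps power2_eq_square)
  \<comment> \<open>Only the second occurrence of \<open>s0_x\<close> is unfolded; the first belongs
    to the substitution itself.\<close>
  have "evaluates ?\<sigma> s0_x \<x>"
    by (subst (2) s0_x_eq, rule evaluates_eqI, (rule evaluates_intros ev nz)+,
        rule s0_involution[OF _ _ denominators_nonzero(1) s0_x_eq eq nz]) simp_all
  moreover have "evaluates ?\<sigma> (\<h>\<^sub>2 / \<e> 4) (\<e> 3)" "evaluates ?\<sigma> (\<h>\<^sub>2 / \<e> 3) (\<e> 4)"
    "evaluates ?\<sigma> (\<h>\<^sub>1 * \<h>\<^sub>2 / (\<e> 3 * \<e> 4)) \<h>\<^sub>1"
    by (rule evaluates_eqI, (rule evaluates_intros ev | (simp; fail))+)+
  ultimately show "evaluates ?\<sigma> (?\<sigma> v) (gen v)" for v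
    by (cases v) (simp_all add: \<mu>_def generator_defs evaluates_gen_iff)
qed

text \<open>\<open>y'\<close> is affine in \<open>y\<close> with slope
  \<open>(x - h1 / e2) / (x - e3)\<close>. The parameter action exchanges \<open>e3\<close> with
  \<open>h1 / e2\<close>, so the slope is inverted, and the constant terms cancel.\<close>

lemma s2_involution:
  fixes x y h1 h2 e2 e3 :: "'a::field"
  assumes nz: "e2 \<noteq> 0" "e3 \<noteq> 0" "h1 \<noteq> 0" "x - e3 \<noteq> 0"
    and y': "y' = (e2 * e3 * x * y - e3 * (e2 * e3 - h1) * x - e3 * h1 * y - h2 * (e2 * e3 - h1)) / (e2 * e3 * (x - e3))"
    and e: "e2' = h1 / e3" "e3' = h1 / e2" "h2' = h1 * h2 / (e2 * e3)"
    and nz': "e2' * e3' * (x - e3') \<noteq> 0"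
  shows "(e2' * e3' * x * y' - e3' * (e2' * e3' - h1) * x - e3' * h1 * y' - h2' * (e2' * e3' - h1)) / (e2' * e3' * (x - e3')) = y"
proof -
  \<comment> \<open>As a single symbol the denominator can be cleared; it is expanded again only in
    the resulting polynomial identity.\<close>
  define d where "d = x - e3"
  have "d \<noteq> 0" "x = d + e3" using nz by (simp_all add: d_def)
  have "e2' * e3' * x * y' - e3' * (e2' * e3' - h1) * x - e3' * h1 * y' - h2' * (e2' * e3' - h1) = y * (e2' * e3' * (x - e3'))"
    unfolding e y' d_def[symmetric] using nz \<open>d \<noteq> 0\<close>
    by (simp add: divide_simps, unfold \<open>x = d + e3\<close>) algebra
  then show ?thesis using nz' by (simp add: divide_eq_eq)
qed

text \<open>The value of \<open>phi_x\<close> under the inverse substitution: primed letters are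
  images, \<open>h1\<close> goes to \<open>h2\<close>, and the old \<open>x\<close>,
  \<open>y\<close> go to \<open>y\<close>, \<open>y'\<close>.\<close>

lemma phi_psi:
  fixes x y h1 h2 e2 e3 :: "'a::field"
  assumes nz: "e2 \<noteq> 0" "e3 \<noteq> 0" "h2 \<noteq> 0" "x - e3 \<noteq> 0"
    and y': "y' = (e2 * e3 * x * y - e3 * (e2 * e3 - h1) * x - e3 * h1 * y - h2 * (e2 * e3 - h1)) / (e2 * e3 * (x - e3))"
    and e: "e3' = h2 / e3" "h2' = h1 * h2 / (e2 * e3)"
    and nz': "e3' * y - e3' * y' - h2 + h2' \<noteq> 0"
  shows "(e3' * (h2 - h2') + h2' * y - h2 * y') / (e3' * y - e3' * y' - h2 + h2') = x"
proof -
  define d where "d = x - e3"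
  have "d \<noteq> 0" "x = d + e3" using nz by (simp_all add: d_def)
  have "e3' * (h2 - h2') + h2' * y - h2 * y' = x * (e3' * y - e3' * y' - h2 + h2')"
    unfolding e y' d_def[symmetric] using nz \<open>d \<noteq> 0\<close>
    by (simp add: divide_simps, unfold \<open>x = d + e3\<close>) algebra
  then show ?thesis using nz' by (simp add: divide_eq_eq)
qed

text \<open>The opposite composition: the value of \<open>s2_y\<close> under the transition
  substitution, where \<open>x\<close>, \<open>y\<close> go to \<open>x'\<close>,
  \<open>x\<close>.\<close>

lemma psi_phi:
  fixes x y h1 h2 e2 e3 :: "'a::field"
  assumes nz: "e2 \<noteq> 0" "e3 \<noteq> 0" "h1 \<noteq> 0" "e3 * x - e3 * y - h1 + h2 \<noteq> 0"
    and x': "x' = (e3 * (h1 - h2) + h2 * x - h1 * y) / (e3 * x - e3 * y - h1 + h2)"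
    and e: "e2' = h1 / e2" "e3' = h1 / e3" "h1' = h1 * h2 / (e2 * e3)"
    and nz': "e2' * e3' * (x' - e3') \<noteq> 0"
  shows "(e2' * e3' * x' * x - e3' * (e2' * e3' - h1') * x' - e3' * h1' * x - h1 * (e2' * e3' - h1')) / (e2' * e3' * (x' - e3')) = y"
proof -
  \<comment> \<open>The denominator is monic in \<open>h2\<close>, so eliminating \<open>h2\<close>
    in favour of \<open>d\<close> introduces no new division.\<close>
  define d where "d = e3 * x - e3 * y - h1 + h2"
  have "d \<noteq> 0" "h2 = d + h1 - e3 * x + e3 * y" using nz by (simp_all add: d_def)
  have "e2' * e3' * x' * x - e3' * (e2' * e3' - h1') * x' - e3' * h1' * x - h1 * (e2' * e3' - h1') = y * (e2' * e3' * (x' - e3'))"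
    unfolding e x' d_def[symmetric] using nz \<open>d \<noteq> 0\<close>
    by (simp add: divide_simps, unfold \<open>h2 = d + h1 - e3 * x + e3 * y\<close>) algebra
  then show ?thesis using nz' by (simp add: divide_eq_eq)
qed

lemma acts_as_s2: "acts_as (aut ((\<nu> 2 3)(Y := s2_y))) ((\<nu> 2 3)(Y := s2_y))"
proof (rule acts_as_aut_involution)
  let ?\<sigma> = "(\<nu> 2 3)(Y := s2_y)"
  have ev: "evaluates ?\<sigma> \<x> \<x>" "evaluates ?\<sigma> \<y> s2_y" "evaluates ?\<sigma> \<h>\<^sub>1 \<h>\<^sub>1"
    "evaluates ?\<sigma> (\<e> 2) (\<h>\<^sub>1 / \<e> 3)" "evaluates ?\<sigma> (\<e> 3) (\<h>\<^sub>1 / \<e> 2)"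
    "evaluates ?\<sigma> \<h>\<^sub>2 (\<h>\<^sub>1 * \<h>\<^sub>2 / (\<e> 2 * \<e> 3))"
    by (simp_all add: generator_defs evaluates_gen_iff \<nu>_def)
  have nz: "\<h>\<^sub>1 / \<e> 3 * (\<h>\<^sub>1 / \<e> 2) * (\<x> - \<h>\<^sub>1 / \<e> 2) \<noteq> 0"
    unfolding generator_defs
    by (rule nonzero_at_sample_point, (rule evaluates_intros | (simp; fail))+)
  have "evaluates ?\<sigma> s2_y \<y>"
    by (subst (2) s2_y_def, rule evaluates_eqI, (rule evaluates_intros ev nz)+,
        rule s2_involution[OF _ _ _ denominators_nonzero(2) s2_y_def refl refl refl nz]) simp_all
  moreover have "evaluates ?\<sigma> (\<h>\<^sub>1 / \<e> 2) (\<e> 3)" "evaluates ?\<sigma> (\<h>\<^sub>1 / \<e> 3) (\<e> 2)"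
    "evaluates ?\<sigma> (\<h>\<^sub>1 * \<h>\<^sub>2 / (\<e> 2 * \<e> 3)) \<h>\<^sub>2"
    by (rule evaluates_eqI, (rule evaluates_intros ev | (simp; fail))+)+
  ultimately show "evaluates ?\<sigma> (?\<sigma> v) (gen v)" for v
    by (cases v) (simp_all add: \<nu>_def generator_defs evaluates_gen_iff)
qed

section \<open>The transition automorphism and its inverse\<close>

definition phi_x :: K where
  "phi_x = (\<e> 3 * (\<h>\<^sub>1 - \<h>\<^sub>2) + \<h>\<^sub>2 * \<x> - \<h>\<^sub>1 * \<y>) / (\<e> 3 * \<x> - \<e> 3 * \<y> - \<h>\<^sub>1 + \<h>\<^sub>2)"

lemma phi_x_mult:
  "phi_x * (\<e> 3 * \<x> - \<e> 3 * \<y> - \<h>\<^sub>1 + \<h>\<^sub>2) = \<e> 3 * (\<h>\<^sub>1 - \<h>\<^sub>2) + \<h>\<^sub>2 * \<x> - \<h>\<^sub>1 * \<y>"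
  using denominators_nonzero(4) by (simp add: phi_x_def)

definition phi_action :: "var \<Rightarrow> K" where
  "phi_action = gen(X := phi_x, Y := \<x>, E2 := \<h>\<^sub>1 / \<e> 2, E3 := \<h>\<^sub>1 / \<e> 3,
     H1 := \<h>\<^sub>1 * \<h>\<^sub>2 / (\<e> 2 * \<e> 3), H2 := \<h>\<^sub>1)"

text \<open>The relation \<open>phi_x_mult\<close> is linear in \<open>\<y>\<close>. Solving it for
  \<open>\<y>\<close> and rewriting the solution in the inverse images of the other generators gives
  exactly \<open>s2_y\<close>; for the same reason the conjugate of s2 exchanges the two
  coordinates.\<close>

definition psi_action :: "var \<Rightarrow> K" where
  "psi_action = gen(X := \<y>, Y := s2_y, E2 := \<h>\<^sub>2 / \<e> 2, E3 := \<h>\<^sub>2 / \<e> 3,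
     H1 := \<h>\<^sub>2, H2 := \<h>\<^sub>1 * \<h>\<^sub>2 / (\<e> 2 * \<e> 3))"

lemma acts_as_phi23: "acts_as phi23 phi_action"
proof -
  have ev: "evaluates psi_action \<x> \<y>" "evaluates psi_action \<y> s2_y" "evaluates psi_action \<h>\<^sub>1 \<h>\<^sub>2"
    "evaluates psi_action (\<e> 2) (\<h>\<^sub>2 / \<e> 2)" "evaluates psi_action (\<e> 3) (\<h>\<^sub>2 / \<e> 3)"
    "evaluates psi_action \<h>\<^sub>2 (\<h>\<^sub>1 * \<h>\<^sub>2 / (\<e> 2 * \<e> 3))"
    by (simp_all add: generator_defs evaluates_gen_iff psi_action_def)
  have nz: "\<h>\<^sub>2 / \<e> 3 * \<y> - \<h>\<^sub>2 / \<e> 3 * s2_y - \<h>\<^sub>2 + \<h>\<^sub>1 * \<h>\<^sub>2 / (\<e> 2 * \<e> 3) \<noteq> 0"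
    unfolding s2_y_def generator_defs
    by (rule nonzero_at_sample_point, (rule evaluates_intros | (simp; fail))+)
  have "evaluates psi_action phi_x \<x>"
    by (subst phi_x_def, rule evaluates_eqI, (rule evaluates_intros ev nz)+,
        rule phi_psi[OF _ _ _ denominators_nonzero(2) s2_y_def refl refl nz]) simp_all
  moreover have "evaluates psi_action (\<h>\<^sub>1 / \<e> 2) (\<e> 2)" "evaluates psi_action (\<h>\<^sub>1 / \<e> 3) (\<e> 3)"
    "evaluates psi_action (\<h>\<^sub>1 * \<h>\<^sub>2 / (\<e> 2 * \<e> 3)) \<h>\<^sub>1"
    by (rule evaluates_eqI, (rule evaluates_intros ev | (simp; fail))+)+
  ultimately have 1: "evaluates psi_action (phi_action v) (gen v)" for v
    using ev by (cases v) (simp_all add: phi_action_def psi_action_def generator_defs evaluates_gen_iff)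
  have ev: "evaluates phi_action \<x> phi_x" "evaluates phi_action \<y> \<x>" "evaluates phi_action \<h>\<^sub>2 \<h>\<^sub>1"
    "evaluates phi_action (\<e> 2) (\<h>\<^sub>1 / \<e> 2)" "evaluates phi_action (\<e> 3) (\<h>\<^sub>1 / \<e> 3)"
    "evaluates phi_action \<h>\<^sub>1 (\<h>\<^sub>1 * \<h>\<^sub>2 / (\<e> 2 * \<e> 3))"
    by (simp_all add: generator_defs evaluates_gen_iff phi_action_def)
  have nz: "\<h>\<^sub>1 / \<e> 2 * (\<h>\<^sub>1 / \<e> 3) * (phi_x - \<h>\<^sub>1 / \<e> 3) \<noteq> 0"
    unfolding phi_x_def generator_defs
    by (rule nonzero_at_sample_point, (rule evaluates_intros | (simp; fail))+)
  have "evaluates phi_action s2_y \<y>"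
    by (subst s2_y_def, rule evaluates_eqI, (rule evaluates_intros ev nz)+,
        rule psi_phi[OF _ _ _ denominators_nonzero(4) phi_x_def refl refl refl nz]) simp_all
  moreover have "evaluates phi_action (\<h>\<^sub>2 / \<e> 2) (\<e> 2)" "evaluates phi_action (\<h>\<^sub>2 / \<e> 3) (\<e> 3)"
    "evaluates phi_action (\<h>\<^sub>1 * \<h>\<^sub>2 / (\<e> 2 * \<e> 3)) \<h>\<^sub>2"
    by (rule evaluates_eqI, (rule evaluates_intros ev | (simp; fail))+)+
  ultimately have 2: "evaluates phi_action (psi_action v) (gen v)" for v
    using ev by (cases v) (simp_all add: phi_action_def psi_action_def generator_defs evaluates_gen_iff)
  have "phi23 = aut phi_action"
    by (simp add: phi23_def phi_action_def phi_x_def)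
  then show ?thesis
    using acts_as_aut[OF 1 2] by simp
qed

section \<open>The automorphism pi of representation 2\<close>

definition pi_y :: K where
  "pi_y = \<h>\<^sub>1 * (\<h>\<^sub>2 * \<x>\<^sup>2 * \<y> - \<h>\<^sub>2 * \<b> \<e> 1 * \<x>\<^sup>2
            - (\<b> \<e> 4 - \<h>\<^sub>2 * \<b> \<e> 2 + \<h>\<^sub>2\<^sup>2) * \<x> + \<b> \<e> 4 * \<y> - \<h>\<^sub>2 * \<b> \<e> 3)
          / (\<b> \<e> 4 * (\<x> * \<y> - \<x>\<^sup>2 - \<h>\<^sub>2))"

definition pi_action :: "var \<Rightarrow> K" where
  "pi_action = gen(
     H1 := \<h>\<^sub>1, H2 := \<h>\<^sub>1\<^sup>2 * \<h>\<^sub>2 / (\<e> 3 * \<e> 4 * \<e> 5 * \<e> 6),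
     E1 := \<e> 8, E8 := \<e> 1, E2 := \<e> 7, E7 := \<e> 2,
     E3 := \<h>\<^sub>1 / \<e> 6, E4 := \<h>\<^sub>1 / \<e> 5, E5 := \<h>\<^sub>1 / \<e> 4, E6 := \<h>\<^sub>1 / \<e> 3,
     X := \<h>\<^sub>1 / \<x>, Y := pi_y)"

lemma acts_as_pi_rep2: "acts_as pi_rep2 pi_action"
proof -
  have ev: "evaluates pi_action \<x> (\<h>\<^sub>1 / \<x>)" "evaluates pi_action \<y> pi_y"
    "evaluates pi_action \<h>\<^sub>1 \<h>\<^sub>1"
    "evaluates pi_action \<h>\<^sub>2 (\<h>\<^sub>1\<^sup>2 * \<h>\<^sub>2 / (\<e> 3 * \<e> 4 * \<e> 5 * \<e> 6))"
    "evaluates pi_action (\<e> 3) (\<h>\<^sub>1 / \<e> 6)" "evaluates pi_action (\<e> 4) (\<h>\<^sub>1 / \<e> 5)"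
    "evaluates pi_action (\<e> 5) (\<h>\<^sub>1 / \<e> 4)" "evaluates pi_action (\<e> 6) (\<h>\<^sub>1 / \<e> 3)"
    by (simp_all add: generator_defs evaluates_gen_iff pi_action_def)
  \<comment> \<open>Up to \<open>\<h>\<^sub>1\<close> the four parameters are inverted and permuted,
    so elementary symmetric functions are reversed: b_k goes to h1^k b_(4-k) / b_4, with b_0 =
    1.\<close>
  have ev_b: "evaluates pi_action (\<b> \<e> 1) (\<h>\<^sub>1 * \<b> \<e> 3 / \<b> \<e> 4)"
    "evaluates pi_action (\<b> \<e> 2) (\<h>\<^sub>1\<^sup>2 * \<b> \<e> 2 / \<b> \<e> 4)"
    "evaluates pi_action (\<b> \<e> 3) (\<h>\<^sub>1 ^ 3 * \<b> \<e> 1 / \<b> \<e> 4)"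
    "evaluates pi_action (\<b> \<e> 4) (\<h>\<^sub>1 ^ 4 / \<b> \<e> 4)"
    unfolding \<b>_simps
    by (rule evaluates_eqI, (rule evaluates_intros ev)+, simp add: field_simps eval_nat_numeral)+
  have ev_h2: "evaluates pi_action \<h>\<^sub>2 (\<h>\<^sub>1\<^sup>2 * \<h>\<^sub>2 / \<b> \<e> 4)"
    using ev(4) by (simp add: \<b>_simps)
  have b4: "\<b> \<e> 4 \<noteq> 0"
    by (simp add: \<b>_simps)
  have nz': "\<h>\<^sub>1 / \<x> * pi_y - (\<h>\<^sub>1 / \<x>)\<^sup>2 - \<h>\<^sub>1\<^sup>2 * \<h>\<^sub>2 / \<b> \<e> 4 \<noteq> 0"
    unfolding pi_y_def \<b>_simps generator_defs
    by (rule nonzero_at_sample_point, (rule evaluates_intros | (simp; fail) | (simp add: divide_simps; fail))+)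
  have nz: "\<h>\<^sub>1 ^ 4 / \<b> \<e> 4 * (\<h>\<^sub>1 / \<x> * pi_y - (\<h>\<^sub>1 / \<x>)\<^sup>2 - \<h>\<^sub>1\<^sup>2 * \<h>\<^sub>2 / \<b> \<e> 4) \<noteq> 0"
    using nz' b4 by simp
  have "evaluates pi_action pi_y \<y>"
    by (subst pi_y_def, rule evaluates_eqI, (rule evaluates_intros ev(1-3) ev_b ev_h2 nz)+,
        rule pi_involution[OF b4 _ _ _ denominators_nonzero(3) pi_y_def refl refl refl refl refl refl nz'])
      simp_all
  moreover have "evaluates pi_action (\<h>\<^sub>1 / \<x>) \<x>"
    "evaluates pi_action (\<h>\<^sub>1 / \<e> 6) (\<e> 3)" "evaluates pi_action (\<h>\<^sub>1 / \<e> 5) (\<e> 4)"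
    "evaluates pi_action (\<h>\<^sub>1 / \<e> 4) (\<e> 5)" "evaluates pi_action (\<h>\<^sub>1 / \<e> 3) (\<e> 6)"
    by (rule evaluates_eqI, (rule evaluates_intros ev | (simp; fail))+)+
  moreover have "evaluates pi_action (\<h>\<^sub>1\<^sup>2 * \<h>\<^sub>2 / (\<e> 3 * \<e> 4 * \<e> 5 * \<e> 6)) \<h>\<^sub>2"
    by (rule evaluates_eqI, (rule evaluates_intros ev | (simp; fail))+)
      (simp add: field_simps eval_nat_numeral)
  ultimately have "evaluates pi_action (pi_action v) (gen v)" for v
    using ev(3) by (cases v) (simp_all add: pi_action_def generator_defs evaluates_gen_iff)
  then have "acts_as (aut pi_action) pi_action"
    by (rule acts_as_aut_involution)
  moreover have "pi_rep2 = aut pi_action"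
    by (simp add: pi_rep2_def pi_action_def pi_y_def)
  ultimately show ?thesis
    by simp
qed

section \<open>Conjugation by the transition automorphism\<close>

text \<open>
  The conjugate \<open>g\<close> satisfies \<open>g (phi23 F) = phi23 (s F)\<close>. For \<open>F\<close> a generator this determines
  \<open>g\<close> on the generators, the value at \<open>Y\<close> being the solution of an equation that is linear because
  \<open>phi23\<close> sends \<open>X\<close> to a fractional linear expression in \<open>Y\<close>.
\<close>

lemma acts_as_conjugate_phi23:
  assumes s: "acts_as s \<sigma>"
    and unmoved: "\<And>v. v \<in> {E1, E4, E5, E6, E7, E8} \<Longrightarrow> phi23 (\<sigma> v) = \<tau> v"
    and H1: "phi23 (\<sigma> H2) = \<tau> H1"
    and E2: "\<tau> E2 * phi23 (\<sigma> E2) = \<tau> H1"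
    and E3: "\<tau> E3 * phi23 (\<sigma> E3) = \<tau> H1"
    and H2: "\<tau> H1 * \<tau> H2 = \<tau> E2 * \<tau> E3 * phi23 (\<sigma> H1)"
    and X: "phi23 (\<sigma> Y) = \<tau> X"
    and Y: "phi23 (\<sigma> X) * (\<tau> E3 * \<tau> X - \<tau> E3 * \<tau> Y - \<tau> H1 + \<tau> H2)
      = \<tau> E3 * (\<tau> H1 - \<tau> H2) + \<tau> H2 * \<tau> X - \<tau> H1 * \<tau> Y"
  shows "acts_as (phi23 \<circ> s \<circ> inv phi23) \<tau>"
proof -
  let ?g = "phi23 \<circ> s \<circ> inv phi23"
  have phi: "C_automorphism phi23" "\<And>v. phi23 (gen v) = phi_action v"
    using acts_as_phi23 by (simp_all add: acts_as_def)
  have g: "C_automorphism ?g"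
    using s phi(1) by (intro C_automorphism_comp C_automorphism_inv) (simp_all add: acts_as_def)
  have g_phi: "?g (phi_action v) = phi23 (\<sigma> v)" for v
  proof -
    have "inv phi23 (phi_action v) = gen v"
      using bij_aut[OF phi(1)] phi(2)[of v] by (metis bij_inv_eq_iff)
    then show ?thesis
      using s by (simp add: acts_as_def)
  qed
  note hom = aut_hom[OF g]
  define G where "G = ?g"
  note hom = hom[folded G_def] and g_phi = g_phi[folded G_def] and nz0 = aut_eq_0_iff[OF g, folded G_def]
  have h1: "G \<h>\<^sub>1 = \<tau> H1"
    using g_phi[of H2] H1 by (simp add: phi_action_def)
  have x: "G \<x> = \<tau> X"
    using g_phi[of Y] X by (simp add: phi_action_def)
  have nz: "G F \<noteq> 0" if "F \<noteq> 0" for F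
    using that nz0 by simp
  have \<tau>H1: "\<tau> H1 \<noteq> 0"
    using nz[of "\<h>\<^sub>1"] h1 by simp
  have e2: "G (\<e> 2) = \<tau> E2"
  proof -
    have "phi23 (\<sigma> E2) = \<tau> H1 / G (\<e> 2)"
      using g_phi[of E2] by (simp add: phi_action_def hom h1)
    then show ?thesis
      using E2 \<tau>H1 nz[of "\<e> 2"] by (simp add: divide_eq_eq)
  qed
  have e3: "G (\<e> 3) = \<tau> E3"
  proof -
    have "phi23 (\<sigma> E3) = \<tau> H1 / G (\<e> 3)"
      using g_phi[of E3] by (simp add: phi_action_def hom h1)
    then show ?thesis
      using E3 \<tau>H1 nz[of "\<e> 3"] by (simp add: divide_eq_eq)
  qed
  have h2: "G \<h>\<^sub>2 = \<tau> H2"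
  proof -
    have "phi23 (\<sigma> H1) = \<tau> H1 * G \<h>\<^sub>2 / (\<tau> E2 * \<tau> E3)"
      using g_phi[of H1] by (simp add: phi_action_def hom h1 e2 e3)
    then have "\<tau> H1 * \<tau> H2 = \<tau> H1 * G \<h>\<^sub>2"
      using H2 nz[of "\<e> 2"] nz[of "\<e> 3"] by (simp add: e2 e3)
    then show ?thesis
      using \<tau>H1 by simp
  qed
  have y: "G \<y> = \<tau> Y"
  proof -
    \<comment> \<open>Up to sign the coefficient of \<open>\<y>\<close> in the linear equation. It
      is nonzero in \<open>K\<close>, hence so is its image under the injective \<open>G\<close>,
      and the equation has only one solution.\<close>
    have "phi_x * \<e> 3 - \<h>\<^sub>1 \<noteq> 0"
      unfolding phi_x_def generator_defs
      by (rule nonzero_at_sample_point, (rule evaluates_intros | (simp; fail))+)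
    then have "G (phi_x * \<e> 3 - \<h>\<^sub>1) \<noteq> 0"
      by (rule nz)
    then have coeff: "phi23 (\<sigma> X) * \<tau> E3 - \<tau> H1 \<noteq> 0"
      using g_phi[of X] by (simp add: phi_action_def hom h1 e3)
    have "G (phi_x * (\<e> 3 * \<x> - \<e> 3 * \<y> - \<h>\<^sub>1 + \<h>\<^sub>2)) = G (\<e> 3 * (\<h>\<^sub>1 - \<h>\<^sub>2) + \<h>\<^sub>2 * \<x> - \<h>\<^sub>1 * \<y>)"
      by (rule arg_cong[OF phi_x_mult])
    then have "phi23 (\<sigma> X) * (\<tau> E3 * \<tau> X - \<tau> E3 * G \<y> - \<tau> H1 + \<tau> H2)
      = \<tau> E3 * (\<tau> H1 - \<tau> H2) + \<tau> H2 * \<tau> X - \<tau> H1 * G \<y>"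
      using g_phi[of X] by (simp add: phi_action_def hom h1 h2 e3 x)
    then have "(phi23 (\<sigma> X) * \<tau> E3 - \<tau> H1) * (G \<y> - \<tau> Y) = 0"
      using Y by algebra
    then show ?thesis
      using coeff by simp
  qed
  have "G (gen v) = \<tau> v" for v
    using h1 h2 e2 e3 x y g_phi[of v] unmoved[of v]
    by (cases v) (simp_all add: generator_defs phi_action_def)
  then show ?thesis
    using g by (simp add: acts_as_def G_def)
qed

section \<open>Rational identities behind the conjugates\<close>

text \<open>The fraction is the image of \<open>s0_x\<close> under \<open>phi23\<close>, with
  \<open>P\<close> for \<open>phi_x\<close>. It satisfies the relation of \<open>phi_x\<close> with
  \<open>e4\<close> in place of \<open>e3\<close>, as the exchange of these two parameters
  demands.\<close>

lemma conjugation_s0: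
  fixes x y h1 h2 e3 e4 :: "'a::field"
  assumes nz: "e3 \<noteq> 0" "(h1 - h1 / e3 * e4) * P + h1 / e3 * e4 * x - (h1 / e3 + e4) * h1 \<noteq> 0"
    and P: "P * (e3 * x - e3 * y - h1 + h2) = e3 * (h1 - h2) + h2 * x - h1 * y"
  shows "h1 * (P * x - (h1 / e3 + e4) * P + h1 / e3 * e4 - h1)
      / ((h1 - h1 / e3 * e4) * P + h1 / e3 * e4 * x - (h1 / e3 + e4) * h1)
      * (e4 * x - e4 * y - h1 + h2) = e4 * (h1 - h2) + h2 * x - h1 * y"
proof -
  define t where "t = h1 / e3"
  have t: "t * e3 = h1"
    using nz by (simp add: t_def)
  have "e3 * (h1 * (P * x - (t + e4) * P + t * e4 - h1) * (e4 * x - e4 * y - h1 + h2))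
    = e3 * ((e4 * (h1 - h2) + h2 * x - h1 * y) * ((h1 - t * e4) * P + t * e4 * x - (t + e4) * h1))"
    using P t by algebra
  then show ?thesis
    using nz by (simp add: divide_eq_eq flip: t_def)
qed

text \<open>The relation for \<open>P\<close> is homogeneous linear in \<open>h1 - h2\<close>,
  \<open>x - y\<close> and \<open>h2 * x - h1 * y\<close>, and the substitution multiplies all three
  by the same factor \<open>h1 * (p - h2) / (p * (h1 - h2))\<close>. In the application
  \<open>p\<close> is e1 e2.\<close>

lemma conjugation_s1:
  fixes x y h1 h2 e3 p :: "'a::field"
  assumes nz: "p \<noteq> 0" "h1 - h2 \<noteq> 0"
    and P: "P * (e3 * x - e3 * y - h1 + h2) = e3 * (h1 - h2) + h2 * x - h1 * y"
    and y': "y' = (- h2 * (p - h1) * x + h1 * (p - h2) * y) / (p * (h1 - h2))"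
    and h2': "h2' = h1 * h2 / p"
  shows "P * (e3 * x - e3 * y' - h1 + h2') = e3 * (h1 - h2') + h2' * x - h1 * y'"
proof -
  have "y' * (p * (h1 - h2)) = - h2 * (p - h1) * x + h1 * (p - h2) * y" "h2' * p = h1 * h2"
    using nz by (simp_all add: y' h2')
  then have "p * (h1 - h2) * (P * (e3 * x - e3 * y' - h1 + h2')) = p * (h1 - h2) * (e3 * (h1 - h2') + h2' * x - h1 * y')"
    using P by algebra
  then show ?thesis
    using nz by simp
qed

text \<open>The exchange of e3 and e4 in representation 2 fixes \<open>x\<close>, so its conjugate
  must fix \<open>phi_x\<close> although \<open>e3\<close> and \<open>h2\<close> move;
  \<open>y'\<close> solves the resulting linear equation.\<close>

lemma conjugation_s3:
  fixes x y h1 h2 e3 e4 :: "'a::field"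
  assumes nz: "e3 \<noteq> 0" "e4 \<noteq> 0" "(e3 * e4 - h2) * x - (e3 * e4 - h1) * y - (e3 + e4) * (h1 - h2) \<noteq> 0"
    and P: "P * (e3 * x - e3 * y - h1 + h2) = e3 * (h1 - h2) + h2 * x - h1 * y"
    and y': "y' = (e3 * e4 * (h1 - h2) * x * y + (e3 + e4) * h2 * (e3 * e4 - h1) * x
      - (e3 + e4) * h1 * (e3 * e4 - h2) * y + (e3 * e4 - h1) * (e3 * e4 - h2) * (h1 - h2))
      / (e3 * e4 * ((e3 * e4 - h2) * x - (e3 * e4 - h1) * y - (e3 + e4) * (h1 - h2)))"
    and e3': "e3' = h1 / e4" and h2': "h2' = h1 * h2 / (e3 * e4)"
  shows "P * (e3' * x - e3' * y' - h1 + h2') = e3' * (h1 - h2') + h2' * x - h1 * y'"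
proof -
  define d where "d = (e3 * e4 - h2) * x - (e3 * e4 - h1) * y - (e3 + e4) * (h1 - h2)"
  have d: "d \<noteq> 0"
    using nz by (simp add: d_def)
  have y': "y' * (e3 * e4 * d) = e3 * e4 * (h1 - h2) * x * y + (e3 + e4) * h2 * (e3 * e4 - h1) * x
      - (e3 + e4) * h1 * (e3 * e4 - h2) * y + (e3 * e4 - h1) * (e3 * e4 - h2) * (h1 - h2)"
    using nz d unfolding y' by (simp flip: d_def)
  \<comment> \<open>Both sides are linear in \<open>y'\<close>. Clearing denominators collects it
    into \<open>y' * (e3 * e4 * d)\<close>, which is already known as a polynomial.\<close>
  have 1: "e4 * e3 * e4 * d * (P * (e3' * x - e3' * y' - h1 + h2'))
    = h1 * P * (e3 * e4 * d * x - y' * (e3 * e4 * d) - e3 * e4 * e4 * d + h2 * e4 * d)"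
    using nz unfolding e3' h2' by (simp add: field_simps)
  have 2: "e4 * e3 * e4 * d * (e3' * (h1 - h2') + h2' * x - h1 * y')
    = h1 * ((h1 * e3 * e4 - h1 * h2) * d + h2 * e4 * d * x - e4 * (y' * (e3 * e4 * d)))"
    using nz unfolding e3' h2' by (simp add: field_simps)
  have "e4 * e3 * e4 * d * (P * (e3' * x - e3' * y' - h1 + h2')) = e4 * e3 * e4 * d * (e3' * (h1 - h2') + h2' * x - h1 * y')"
    unfolding 1 2 y' unfolding d_def using P by algebra
  then show ?thesis
    using nz d by simp
qed

text \<open>The polynomial \<open>F\<close> below is a common factor of numerator and denominator and cancels.\<close>

lemma conjugation_pi_x:
  fixes x y h1 h2 e2 e3 c1 c2 c3 :: "'a::field"
  assumes nz: "e2 \<noteq> 0" "e3 \<noteq> 0" "c3 \<noteq> 0" "h1 \<noteq> 0" "e3 * x - e3 * y - h1 + h2 \<noteq> 0" "P * x - P\<^sup>2 - h1 \<noteq> 0"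
    and P: "P = (e3 * (h1 - h2) + h2 * x - h1 * y) / (e3 * x - e3 * y - h1 + h2)"
    and b: "b1 = h1 / e3 + c1" "b2 = h1 / e3 * c1 + c2" "b3 = h1 / e3 * c2 + c3" "b4 = h1 / e3 * c3"
    and H: "H = h1 * h2 / (e2 * e3)"
  shows "H * (h1 * P\<^sup>2 * x - h1 * b1 * P\<^sup>2 - (b4 - h1 * b2 + h1\<^sup>2) * P + b4 * x - h1 * b3)
      / (b4 * (P * x - P\<^sup>2 - h1))
    = h1 * h2 * ((e3 * c3 * (x - y) - (h1 - h2) * (e3 * c2 + c3)) * (x - y)
        + (h2 * x - h1 * y + (h1 - h2) * (e3 + c1)) * (h2 * x - h1 * y)
        + (e3 * c1 + c2) * (h1 - h2)\<^sup>2)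
      / (e2 * (e3 * c3) * (h2 * x\<^sup>2 + h1 * y\<^sup>2 - (h1 + h2) * x * y + (h1 - h2)\<^sup>2))"
proof -
  define N D Q F M where defs: "N = e3 * (h1 - h2) + h2 * x - h1 * y"
    "D = e3 * x - e3 * y - h1 + h2"
    "Q = h2 * x\<^sup>2 + h1 * y\<^sup>2 - (h1 + h2) * x * y + (h1 - h2)\<^sup>2"
    "F = e3 * x - e3\<^sup>2 - h1"
    "M = (e3 * c3 * (x - y) - (h1 - h2) * (e3 * c2 + c3)) * (x - y)
        + (h2 * x - h1 * y + (h1 - h2) * (e3 + c1)) * (h2 * x - h1 * y)
        + (e3 * c1 + c2) * (h1 - h2)\<^sup>2"
  have D: "D \<noteq> 0"
    using nz by (simp add: defs)
  have P: "P = N / D"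
    by (simp add: P defs)
  \<comment> \<open>Origin of \<open>F\<close>: since
    \<open>e3 * N - h1 * D = - (h1 - h2) * F\<close>, the value \<open>P\<close> is
    \<open>h1 / e3\<close> where \<open>F\<close> vanishes, and there t^2 - x t + h1 has the roots
    \<open>e3\<close> and \<open>h1 / e3\<close>.\<close>
  have 1: "P * x - P\<^sup>2 - h1 = F * Q / D\<^sup>2"
  proof -
    have "P * x - P\<^sup>2 - h1 = (N * D * x - N\<^sup>2 - h1 * D\<^sup>2) / D\<^sup>2"
      using D by (simp add: P field_simps power2_eq_square)
    also have "N * D * x - N\<^sup>2 - h1 * D\<^sup>2 = F * Q"
      unfolding defs by algebra
    finally show ?thesis .
  qed
  have 2: "h1 * P\<^sup>2 * x - h1 * b1 * P\<^sup>2 - (b4 - h1 * b2 + h1\<^sup>2) * P + b4 * x - h1 * b3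
    = h1 * (F * M) / (e3 * D\<^sup>2)"
  proof -
    have "h1 * P\<^sup>2 * x - h1 * b1 * P\<^sup>2 - (b4 - h1 * b2 + h1\<^sup>2) * P + b4 * x - h1 * b3
      = h1 * (e3 * N\<^sup>2 * x - (h1 + e3 * c1) * N\<^sup>2 - (c3 - h1 * c1 - e3 * c2 + e3 * h1) * (N * D)
         + (c3 * x - h1 * c2 - e3 * c3) * D\<^sup>2) / (e3 * D\<^sup>2)"
      using D nz by (simp add: P b field_simps power2_eq_square)
    also have "e3 * N\<^sup>2 * x - (h1 + e3 * c1) * N\<^sup>2 - (c3 - h1 * c1 - e3 * c2 + e3 * h1) * (N * D)
         + (c3 * x - h1 * c2 - e3 * c3) * D\<^sup>2 = F * M"
      unfolding defs by algebra
    finally show ?thesis .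
  qed
  have "F \<noteq> 0" "Q \<noteq> 0"
    using nz(6) unfolding 1 by auto
  then have "H * (h1 * (F * M) / (e3 * D\<^sup>2)) / (b4 * (F * Q / D\<^sup>2)) = h1 * h2 * M / (e2 * (e3 * c3) * Q)"
    using D nz by (simp add: H b field_simps)
  then show ?thesis
    unfolding 1 2 unfolding defs .
qed

text \<open>
  Both sides are explicit multiples of expressions in the coefficients of \<open>M e = A + e * B\<close>, and
  \<open>D * (A - e4 * e5 * Q) = N * (e3 * Q - B)\<close> identifies them.
\<close>

lemma conjugation_pi_y:
  fixes x y h1 h2 e3 e4 e5 e6 e7 T :: "'a::field"
  assumes nz: "e3 \<noteq> 0" "e4 \<noteq> 0" "e5 \<noteq> 0" "e6 \<noteq> 0" "e7 \<noteq> 0" "N \<noteq> 0" "Q \<noteq> 0"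
    and N: "N = e3 * (h1 - h2) + h2 * x - h1 * y" and D: "D = e3 * x - e3 * y - h1 + h2"
    and Q: "Q = h2 * x\<^sup>2 + h1 * y\<^sup>2 - (h1 + h2) * x * y + (h1 - h2)\<^sup>2"
    and M: "\<And>e. M e = (e3 * e4 * e5 * e * (x - y)
          - (h1 - h2) * (e3 * e4 * e5 + e3 * e4 * e + e3 * e5 * e + e4 * e5 * e)) * (x - y)
        + (h2 * x - h1 * y + (h1 - h2) * (e3 + e4 + e5 + e)) * (h2 * x - h1 * y)
        + (e3 * e4 + e3 * e5 + e3 * e + e4 * e5 + e4 * e + e5 * e) * (h1 - h2)\<^sup>2"
    and x': "x' = T * M e6 / (e3 * e4 * e5 * e6 * Q)"
    and y': "y' = T * M e7 / (e3 * e4 * e5 * e7 * Q)"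
    and e3': "e3' = T / (e4 * e5)"
    and h': "h1' = T\<^sup>2 / (e3 * e4 * e5 * e6)" "h2' = T\<^sup>2 / (e3 * e4 * e5 * e7)"
  shows "T * D / (e3 * N) * (e3' * x' - e3' * y' - h1' + h2') = e3' * (h1' - h2') + h2' * x' - h1' * y'"
proof -
  define A where "A = - (h1 - h2) * (e3 * e4 * e5) * (x - y) + (h2 * x - h1 * y)\<^sup>2
    + (h1 - h2) * (e3 + e4 + e5) * (h2 * x - h1 * y) + (e3 * e4 + e3 * e5 + e4 * e5) * (h1 - h2)\<^sup>2"
  define B where "B = e3 * e4 * e5 * (x - y)\<^sup>2 - (h1 - h2) * (e3 * e4 + e3 * e5 + e4 * e5) * (x - y)
    + (h1 - h2) * (h2 * x - h1 * y) + (e3 + e4 + e5) * (h1 - h2)\<^sup>2"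
  have M: "M e = A + e * B" for e
    unfolding M A_def B_def by algebra
  have key: "D * (A - e4 * e5 * Q) = N * (e3 * Q - B)"
    unfolding A_def B_def N D Q by algebra
  \<comment> \<open>The values at \<open>e6\<close> and \<open>e7\<close> are subtracted with
    different weights: here \<open>B\<close> cancels, in the second equation \<open>A\<close> does,
    and both keep the factor \<open>e7 - e6\<close>.\<close>
  have 1: "e3' * x' - e3' * y' - h1' + h2'
    = T\<^sup>2 * (e7 - e6) / (e3 * (e4 * e5)\<^sup>2 * e6 * e7 * Q) * (A - e4 * e5 * Q)"
    unfolding e3' x' y' h' M using nz by (simp add: field_simps power2_eq_square)
  have 2: "e3' * (h1' - h2') + h2' * x' - h1' * y'
    = T ^ 3 * (e7 - e6) / (e3\<^sup>2 * (e4 * e5)\<^sup>2 * e6 * e7 * Q) * (e3 * Q - B)"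
    unfolding e3' x' y' h' M using nz by (simp add: field_simps eval_nat_numeral)
  have "T * D / (e3 * N) * (T\<^sup>2 * (e7 - e6) / (e3 * (e4 * e5)\<^sup>2 * e6 * e7 * Q) * (A - e4 * e5 * Q))
    = T ^ 3 * (e7 - e6) / (e3\<^sup>2 * (e4 * e5)\<^sup>2 * e6 * e7 * Q) * (D * (A - e4 * e5 * Q) / N)"
    using nz by (simp add: power2_eq_square power3_eq_cube mult_ac)
  also have "D * (A - e4 * e5 * Q) / N = e3 * Q - B"
    unfolding key using nz by simp
  finally show ?thesis
    unfolding 1 2 .
qed

section \<open>The conjugates, generator by generator\<close>

lemma phi23_hom [simp]:
  "phi23 (a + b) = phi23 a + phi23 b" "phi23 (a * b) = phi23 a * phi23 b"
  "phi23 (a - b) = phi23 a - phi23 b" "phi23 (a / b) = phi23 a / phi23 b"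
  "phi23 (a ^ n) = phi23 a ^ n" "phi23 a = 0 \<longleftrightarrow> a = 0"
  using acts_as_phi23 by (simp_all add: acts_as_def aut_hom aut_eq_0_iff)

lemma phi23_generators [simp]:
  "phi23 (\<e> 1) = \<e> 1" "phi23 (\<e> (Suc 0)) = \<e> 1" "phi23 (\<e> 2) = \<h>\<^sub>1 / \<e> 2" "phi23 (\<e> 3) = \<h>\<^sub>1 / \<e> 3" "phi23 (\<e> 4) = \<e> 4"
  "phi23 (\<e> 5) = \<e> 5" "phi23 (\<e> 6) = \<e> 6" "phi23 (\<e> 7) = \<e> 7" "phi23 (\<e> 8) = \<e> 8"
  "phi23 \<h>\<^sub>1 = \<h>\<^sub>1 * \<h>\<^sub>2 / (\<e> 2 * \<e> 3)" "phi23 \<h>\<^sub>2 = \<h>\<^sub>1" "phi23 \<x> = phi_x" "phi23 \<y> = \<x>"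
  using acts_as_phi23 by (simp_all add: acts_as_def generator_defs phi_action_def)

lemma gen_eq:
  "gen E1 = \<e> 1" "gen E2 = \<e> 2" "gen E3 = \<e> 3" "gen E4 = \<e> 4" "gen E5 = \<e> 5" "gen E6 = \<e> 6"
  "gen E7 = \<e> 7" "gen E8 = \<e> 8" "gen H1 = \<h>\<^sub>1" "gen H2 = \<h>\<^sub>2" "gen X = \<x>" "gen Y = \<y>"
  by (simp_all add: generator_defs)

text \<open>These transpositions permute only parameters that \<open>phi23\<close> fixes and that
  are absent from its formulas, so they commute with it.\<close>

lemma s_rep3_r:
  assumes "s_rep2 k = aut (\<r> i j)" "(i, j) \<in> {(4, 5), (5, 6), (6, 7), (7, 8)}"
  shows "acts_as (s_rep3 k) (\<r> i j)"
  unfolding s_rep3_def assms(1)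
proof (rule acts_as_conjugate_phi23[OF acts_as_r])
  show "phi23 (\<r> i j X) * (\<r> i j E3 * \<r> i j X - \<r> i j E3 * \<r> i j Y - \<r> i j H1 + \<r> i j H2)
      = \<r> i j E3 * (\<r> i j H1 - \<r> i j H2) + \<r> i j H2 * \<r> i j X - \<r> i j H1 * \<r> i j Y"
    using assms(2) phi_x_mult by (auto simp: \<r>_def gen_eq)
qed (use assms(2) in \<open>auto simp: \<r>_def gen_eq\<close>)

lemma s_rep3_0: "acts_as (s_rep3 0) (\<r> 3 4)"
proof -
  have \<sigma>: "s_rep2 0 = aut ((\<mu> 3 4)(X := s0_x))"
    by (simp add: s_rep2_def)
  have W: "phi23 s0_x = \<h>\<^sub>1 * (phi_x * \<x> - (\<h>\<^sub>1 / \<e> 3 + \<e> 4) * phi_x + \<h>\<^sub>1 / \<e> 3 * \<e> 4 - \<h>\<^sub>1)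
      / ((\<h>\<^sub>1 - \<h>\<^sub>1 / \<e> 3 * \<e> 4) * phi_x + \<h>\<^sub>1 / \<e> 3 * \<e> 4 * \<x> - (\<h>\<^sub>1 / \<e> 3 + \<e> 4) * \<h>\<^sub>1)"
    unfolding s0_x_eq by simp
  \<comment> \<open>The image of a nonzero denominator under the injective \<open>phi23\<close>. The
    rule for \<open>phi23 a = 0\<close> is withheld so that \<open>phi23\<close> is pushed inwards
    instead of being dropped.\<close>
  have nz: "(\<h>\<^sub>1 - \<h>\<^sub>1 / \<e> 3 * \<e> 4) * phi_x + \<h>\<^sub>1 / \<e> 3 * \<e> 4 * \<x> - (\<h>\<^sub>1 / \<e> 3 + \<e> 4) * \<h>\<^sub>1 \<noteq> 0"
    using denominators_nonzero(1) phi23_hom(6)[of "(\<h>\<^sub>2 - \<e> 3 * \<e> 4) * \<x> + \<e> 3 * \<e> 4 * \<y> - (\<e> 3 + \<e> 4) * \<h>\<^sub>2"]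
    by (simp del: phi23_hom(6))
  show ?thesis
    unfolding s_rep3_def \<sigma>
  proof (rule acts_as_conjugate_phi23[OF acts_as_s0])
    show "phi23 (((\<mu> 3 4)(X := s0_x)) X) * (\<r> 3 4 E3 * \<r> 3 4 X - \<r> 3 4 E3 * \<r> 3 4 Y - \<r> 3 4 H1 + \<r> 3 4 H2)
      = \<r> 3 4 E3 * (\<r> 3 4 H1 - \<r> 3 4 H2) + \<r> 3 4 H2 * \<r> 3 4 X - \<r> 3 4 H1 * \<r> 3 4 Y"
      using conjugation_s0[OF _ nz phi_x_mult] by (simp add: \<r>_def gen_eq W)
  qed (auto simp: \<r>_def \<mu>_def gen_eq)
qed

lemma s_rep3_1:
  "acts_as (s_rep3 1) ((\<nu> 1 2)(
       Y := (- \<h>\<^sub>2 * (\<e> 1 * \<e> 2 - \<h>\<^sub>1) * \<x> + \<h>\<^sub>1 * (\<e> 1 * \<e> 2 - \<h>\<^sub>2) * \<y>)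
            / (\<e> 1 * \<e> 2 * h_minus)))" (is "acts_as _ ?\<tau>")
proof -
  have \<sigma>: "s_rep2 1 = aut (\<r> 1 2)"
    by (simp add: s_rep2_def)
  show ?thesis
    unfolding s_rep3_def \<sigma>
  proof (rule acts_as_conjugate_phi23[OF acts_as_r])
    show "phi23 (\<r> 1 2 X) * (?\<tau> E3 * ?\<tau> X - ?\<tau> E3 * ?\<tau> Y - ?\<tau> H1 + ?\<tau> H2)
      = ?\<tau> E3 * (?\<tau> H1 - ?\<tau> H2) + ?\<tau> H2 * ?\<tau> X - ?\<tau> H1 * ?\<tau> Y"
      using conjugation_s1[OF _ denominators_nonzero(5) phi_x_mult refl refl, of "\<e> 1 * \<e> 2"]
      by (simp add: \<r>_def \<nu>_def gen_eq h_minus_def)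
  qed (auto simp: \<r>_def \<nu>_def gen_eq)
qed

lemma s_rep3_2: "acts_as (s_rep3 2) (\<c>(X := \<y>, Y := \<x>))" (is "acts_as _ ?\<tau>")
proof -
  have \<sigma>: "s_rep2 2 = aut ((\<nu> 2 3)(Y := s2_y))"
    by (simp add: s_rep2_def)
  have nz: "\<h>\<^sub>1 / \<e> 2 * (\<h>\<^sub>1 / \<e> 3) * (phi_x - \<h>\<^sub>1 / \<e> 3) \<noteq> 0"
    using denominators_nonzero(2) phi23_hom(6)[of "\<x> - \<e> 3"] by (simp del: phi23_hom(6))
  \<comment> \<open>\<open>s2_y\<close> is the preimage of \<open>\<y>\<close> under
    \<open>phi23\<close>, so the identity that established the inverse is reused.\<close>
  have s2_y: "phi23 s2_y = \<y>"
    unfolding s2_y_def phi23_hom phi23_generators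
    by (rule psi_phi[OF _ _ _ denominators_nonzero(4) phi_x_def refl refl refl nz]) simp_all
  show ?thesis
    unfolding s_rep3_def \<sigma>
  proof (rule acts_as_conjugate_phi23[OF acts_as_s2])
    \<comment> \<open>Exchanging both pairs at once changes the sign of both sides of the relation
      for \<open>phi_x\<close>.\<close>
    show "phi23 (((\<nu> 2 3)(Y := s2_y)) X) * (?\<tau> E3 * ?\<tau> X - ?\<tau> E3 * ?\<tau> Y - ?\<tau> H1 + ?\<tau> H2)
      = ?\<tau> E3 * (?\<tau> H1 - ?\<tau> H2) + ?\<tau> H2 * ?\<tau> X - ?\<tau> H1 * ?\<tau> Y"
      using phi_x_mult by (simp add: \<nu>_def \<c>_def gen_eq algebra_simps)
  qed (auto simp: \<nu>_def \<c>_def gen_eq s2_y)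
qed

lemma s_rep3_3:
  "acts_as (s_rep3 3) ((\<nu> 3 4)(
       Y := (\<a> 2 * h_minus * \<x> * \<y> + \<a> 1 * \<h>\<^sub>2 * (\<a> 2 - \<h>\<^sub>1) * \<x>
              - \<a> 1 * \<h>\<^sub>1 * (\<a> 2 - \<h>\<^sub>2) * \<y> + (\<a> 2 - \<h>\<^sub>1) * (\<a> 2 - \<h>\<^sub>2) * h_minus)
            / (\<a> 2 * ((\<a> 2 - \<h>\<^sub>2) * \<x> - (\<a> 2 - \<h>\<^sub>1) * \<y> - \<a> 1 * h_minus))))"
  (is "acts_as _ ?\<tau>")
proof -
  have \<sigma>: "s_rep2 3 = aut (\<r> 3 4)"
    by (simp add: s_rep2_def)
  have nz: "(\<e> 3 * \<e> 4 - \<h>\<^sub>2) * \<x> - (\<e> 3 * \<e> 4 - \<h>\<^sub>1) * \<y> - (\<e> 3 + \<e> 4) * (\<h>\<^sub>1 - \<h>\<^sub>2) \<noteq> 0"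
    unfolding generator_defs
    by (rule nonzero_at_sample_point, (rule evaluates_intros | (simp; fail))+)
  show ?thesis
    unfolding s_rep3_def \<sigma>
  proof (rule acts_as_conjugate_phi23[OF acts_as_r])
    show "phi23 (\<r> 3 4 X) * (?\<tau> E3 * ?\<tau> X - ?\<tau> E3 * ?\<tau> Y - ?\<tau> H1 + ?\<tau> H2)
      = ?\<tau> E3 * (?\<tau> H1 - ?\<tau> H2) + ?\<tau> H2 * ?\<tau> X - ?\<tau> H1 * ?\<tau> Y"
      using conjugation_s3[OF _ _ nz phi_x_mult refl refl refl]
      by (simp add: \<r>_def \<nu>_def gen_eq h_minus_def \<a>_simps)
  qed (auto simp: \<r>_def \<nu>_def gen_eq)
qed

lemma acts_as_pi_rep3:
  "acts_as pi_rep3 (gen(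
       H1 := \<h>\<^sub>1\<^sup>2 * \<h>\<^sub>2\<^sup>2 / ((\<e> 2)\<^sup>2 * \<e> 3 * \<e> 4 * \<e> 5 * \<e> 6),
       H2 := \<h>\<^sub>1\<^sup>2 * \<h>\<^sub>2\<^sup>2 / ((\<e> 2)\<^sup>2 * \<e> 3 * \<e> 4 * \<e> 5 * \<e> 7),
       E1 := \<e> 8,
       E8 := \<e> 1,
       E2 := \<h>\<^sub>1\<^sup>2 * \<h>\<^sub>2\<^sup>2 / ((\<e> 2)\<^sup>2 * \<e> 3 * \<e> 4 * \<e> 5 * \<e> 6 * \<e> 7),
       E3 := \<h>\<^sub>1 * \<h>\<^sub>2 / (\<e> 2 * \<e> 4 * \<e> 5),
       E4 := \<h>\<^sub>1 * \<h>\<^sub>2 / (\<e> 2 * \<e> 3 * \<e> 5),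
       E5 := \<h>\<^sub>1 * \<h>\<^sub>2 / (\<e> 2 * \<e> 3 * \<e> 4),
       E6 := \<h>\<^sub>2 / \<e> 2,
       E7 := \<h>\<^sub>1 / \<e> 2,
       X := \<Phi> \<e>,
       Y := \<Phi> (\<e>(6 := \<e> 7))))" (is "acts_as _ ?\<tau>")
proof -
  \<comment> \<open>The polynomial numerator as a function of the sixth parameter alone; the two
    coordinate images use its values at \<open>\<e> 6\<close> and \<open>\<e> 7\<close>.\<close>
  define M where "M e = (\<e> 3 * \<e> 4 * \<e> 5 * e * (\<x> - \<y>)
          - (\<h>\<^sub>1 - \<h>\<^sub>2) * (\<e> 3 * \<e> 4 * \<e> 5 + \<e> 3 * \<e> 4 * e + \<e> 3 * \<e> 5 * e + \<e> 4 * \<e> 5 * e)) * (\<x> - \<y>)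
        + (\<h>\<^sub>2 * \<x> - \<h>\<^sub>1 * \<y> + (\<h>\<^sub>1 - \<h>\<^sub>2) * (\<e> 3 + \<e> 4 + \<e> 5 + e)) * (\<h>\<^sub>2 * \<x> - \<h>\<^sub>1 * \<y>)
        + (\<e> 3 * \<e> 4 + \<e> 3 * \<e> 5 + \<e> 3 * e + \<e> 4 * \<e> 5 + \<e> 4 * e + \<e> 5 * e) * (\<h>\<^sub>1 - \<h>\<^sub>2)\<^sup>2" for e
  define N where "N = \<e> 3 * (\<h>\<^sub>1 - \<h>\<^sub>2) + \<h>\<^sub>2 * \<x> - \<h>\<^sub>1 * \<y>"
  define D where "D = \<e> 3 * \<x> - \<e> 3 * \<y> - \<h>\<^sub>1 + \<h>\<^sub>2"
  define Q where "Q = \<h>\<^sub>2 * \<x>\<^sup>2 + \<h>\<^sub>1 * \<y>\<^sup>2 - (\<h>\<^sub>1 + \<h>\<^sub>2) * \<x> * \<y> + (\<h>\<^sub>1 - \<h>\<^sub>2)\<^sup>2"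
  have nz: "N \<noteq> 0" "Q \<noteq> 0"
    unfolding N_def Q_def generator_defs
    by (rule nonzero_at_sample_point, (rule evaluates_intros | (simp; fail))+)+
  have X: "?\<tau> X = \<h>\<^sub>1 * \<h>\<^sub>2 / \<e> 2 * M (\<e> 6) / (\<e> 3 * \<e> 4 * \<e> 5 * \<e> 6 * Q)"
    by (simp add: \<Phi>_def \<b>_simps M_def Q_def h_plus_def h_minus_def mult.assoc)
  have Y: "?\<tau> Y = \<h>\<^sub>1 * \<h>\<^sub>2 / \<e> 2 * M (\<e> 7) / (\<e> 3 * \<e> 4 * \<e> 5 * \<e> 7 * Q)"
    by (simp add: \<Phi>_def \<b>_simps M_def Q_def h_plus_def h_minus_def mult.assoc)
  have E3: "?\<tau> E3 = \<h>\<^sub>1 * \<h>\<^sub>2 / \<e> 2 / (\<e> 4 * \<e> 5)"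
    and H1: "?\<tau> H1 = (\<h>\<^sub>1 * \<h>\<^sub>2 / \<e> 2)\<^sup>2 / (\<e> 3 * \<e> 4 * \<e> 5 * \<e> 6)"
    and H2: "?\<tau> H2 = (\<h>\<^sub>1 * \<h>\<^sub>2 / \<e> 2)\<^sup>2 / (\<e> 3 * \<e> 4 * \<e> 5 * \<e> 7)"
    by (simp_all add: power2_eq_square mult_ac)
  have W: "phi23 (pi_action X) = \<h>\<^sub>1 * \<h>\<^sub>2 / \<e> 2 * D / (\<e> 3 * N)"
    by (simp add: pi_action_def phi_x_def N_def D_def)
  \<comment> \<open>Of the four parameters in \<open>\<b>\<close> only the third is moved by
    \<open>phi23\<close>. Splitting it off leaves the elementary symmetric functions of the other
    three, common to \<open>\<b>\<close> and its image.\<close>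
  have phi_b: "phi23 (\<b> \<e> 1) = \<h>\<^sub>1 / \<e> 3 + (\<e> 4 + \<e> 5 + \<e> 6)"
    "phi23 (\<b> \<e> 2) = \<h>\<^sub>1 / \<e> 3 * (\<e> 4 + \<e> 5 + \<e> 6) + (\<e> 4 * \<e> 5 + \<e> 4 * \<e> 6 + \<e> 5 * \<e> 6)"
    "phi23 (\<b> \<e> 3) = \<h>\<^sub>1 / \<e> 3 * (\<e> 4 * \<e> 5 + \<e> 4 * \<e> 6 + \<e> 5 * \<e> 6) + \<e> 4 * \<e> 5 * \<e> 6"
    "phi23 (\<b> \<e> 4) = \<h>\<^sub>1 / \<e> 3 * (\<e> 4 * \<e> 5 * \<e> 6)"
    by (simp_all add: \<b>_simps distrib_left mult.assoc)
  have b: "\<b> \<e> 1 = \<e> 3 + (\<e> 4 + \<e> 5 + \<e> 6)"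
    "\<b> \<e> 2 = \<e> 3 * (\<e> 4 + \<e> 5 + \<e> 6) + (\<e> 4 * \<e> 5 + \<e> 4 * \<e> 6 + \<e> 5 * \<e> 6)"
    "\<b> \<e> 3 = \<e> 3 * (\<e> 4 * \<e> 5 + \<e> 4 * \<e> 6 + \<e> 5 * \<e> 6) + \<e> 4 * \<e> 5 * \<e> 6"
    "\<b> \<e> 4 = \<e> 3 * (\<e> 4 * \<e> 5 * \<e> 6)"
    by (simp_all add: \<b>_simps distrib_left mult.assoc)
  have nz_pi: "phi_x * \<x> - phi_x\<^sup>2 - \<h>\<^sub>1 \<noteq> 0"
    using denominators_nonzero(3) phi23_hom(6)[of "\<x> * \<y> - \<x>\<^sup>2 - \<h>\<^sub>2"] by (simp del: phi23_hom(6))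
  have "phi23 pi_y = \<Phi> \<e>"
    unfolding pi_y_def \<Phi>_def h_plus_def h_minus_def phi23_hom phi_b b unfolding phi23_generators
    by (rule conjugation_pi_x[OF _ _ _ _ denominators_nonzero(4) nz_pi phi_x_def refl refl refl refl refl])
      simp_all
  show ?thesis
    unfolding pi_rep3_def
  proof (rule acts_as_conjugate_phi23[OF acts_as_pi_rep2])
    show "phi23 (pi_action X) * (?\<tau> E3 * ?\<tau> X - ?\<tau> E3 * ?\<tau> Y - ?\<tau> H1 + ?\<tau> H2)
      = ?\<tau> E3 * (?\<tau> H1 - ?\<tau> H2) + ?\<tau> H2 * ?\<tau> X - ?\<tau> H1 * ?\<tau> Y"
      unfolding W X Y E3 H1 H2
      by (rule conjugation_pi_y[OF _ _ _ _ _ nz N_def D_def Q_def M_def refl refl refl refl refl]) simp_all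
  qed (use \<open>phi23 pi_y = \<Phi> \<e>\<close> in \<open>auto simp: pi_action_def gen_eq field_simps power2_eq_square\<close>)
qed

theorem mainTheorem3:
  shows
    "acts_as (s_rep3 0) (\<r> 3 4)
   \<and> acts_as (s_rep3 1) ((\<nu> 1 2)(
       Y := (- \<h>\<^sub>2 * (\<e> 1 * \<e> 2 - \<h>\<^sub>1) * \<x> + \<h>\<^sub>1 * (\<e> 1 * \<e> 2 - \<h>\<^sub>2) * \<y>)
            / (\<e> 1 * \<e> 2 * h_minus)))
   \<and> acts_as (s_rep3 2) (\<c>(X := \<y>, Y := \<x>))
   \<and> acts_as (s_rep3 3) ((\<nu> 3 4)(
       Y := (\<a> 2 * h_minus * \<x> * \<y> + \<a> 1 * \<h>\<^sub>2 * (\<a> 2 - \<h>\<^sub>1) * \<x>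
              - \<a> 1 * \<h>\<^sub>1 * (\<a> 2 - \<h>\<^sub>2) * \<y> + (\<a> 2 - \<h>\<^sub>1) * (\<a> 2 - \<h>\<^sub>2) * h_minus)
            / (\<a> 2 * ((\<a> 2 - \<h>\<^sub>2) * \<x> - (\<a> 2 - \<h>\<^sub>1) * \<y> - \<a> 1 * h_minus))))
   \<and> acts_as (s_rep3 4) (\<r> 4 5)
   \<and> acts_as (s_rep3 5) (\<r> 5 6)
   \<and> acts_as (s_rep3 6) (\<r> 6 7)
   \<and> acts_as (s_rep3 7) (\<r> 7 8)
   \<and> acts_as pi_rep3 (gen(
       H1 := \<h>\<^sub>1\<^sup>2 * \<h>\<^sub>2\<^sup>2 / ((\<e> 2)\<^sup>2 * \<e> 3 * \<e> 4 * \<e> 5 * \<e> 6),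
       H2 := \<h>\<^sub>1\<^sup>2 * \<h>\<^sub>2\<^sup>2 / ((\<e> 2)\<^sup>2 * \<e> 3 * \<e> 4 * \<e> 5 * \<e> 7),
       E1 := \<e> 8,
       E8 := \<e> 1,
       E2 := \<h>\<^sub>1\<^sup>2 * \<h>\<^sub>2\<^sup>2 / ((\<e> 2)\<^sup>2 * \<e> 3 * \<e> 4 * \<e> 5 * \<e> 6 * \<e> 7),
       E3 := \<h>\<^sub>1 * \<h>\<^sub>2 / (\<e> 2 * \<e> 4 * \<e> 5),
       E4 := \<h>\<^sub>1 * \<h>\<^sub>2 / (\<e> 2 * \<e> 3 * \<e> 5),
       E5 := \<h>\<^sub>1 * \<h>\<^sub>2 / (\<e> 2 * \<e> 3 * \<e> 4),
       E6 := \<h>\<^sub>2 / \<e> 2,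
       E7 := \<h>\<^sub>1 / \<e> 2,
       X := \<Phi> \<e>,
       Y := \<Phi> (\<e>(6 := \<e> 7))))"
proof -
  have "acts_as (s_rep3 4) (\<r> 4 5)" "acts_as (s_rep3 5) (\<r> 5 6)"
    "acts_as (s_rep3 6) (\<r> 6 7)" "acts_as (s_rep3 7) (\<r> 7 8)"
    by (simp_all add: s_rep3_r s_rep2_def)
  then show ?thesis
    by (intro conjI s_rep3_0 s_rep3_1 s_rep3_2 s_rep3_3 acts_as_pi_rep3)
qed

end
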